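(* Let $S_1$ and $S_2$ be finite sets, and put $N_0=S_1\cap S_2$, $N_1=S_1\setminus N_0$, $N_2=S_2\setminus N_0$. Let $f_1:\mathbb{Z}^{S_1}\to\mathbb{R}\cup\{+\infty\}$ and $f_2:\mathbb{Z}^{S_2}\to\mathbb{R}\cup\{+\infty\}$ be jump M$^\natural$-convex functions. Let $g:\mathbb{Z}^{N_1\cup N_2}\to\mathbb{R}\cup\{+\infty,-\infty\}$ be their composition, $$g(y_1,y_2)=\inf\{f_1(y_1,z_1)+f_2(y_2,z_2)\mid z_1=z_2\in\mathbb{Z}^{N_0}\}\qquad(y_1\in\mathbb{Z}^{N_1},\ y_2\in\mathbb{Z}^{N_2}).$$ If $g$ does not take the value $-\infty$ and its effective domain is nonempty, then $g$ is jump M$^\natural$-convex.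
   Context: For a finite index set $N$ and a function $f:\mathbb{Z}^N\to\mathbb{R}\cup\{+\infty\}$, the effective domain is $\operatorname{dom} f=\{x\in\mathbb{Z}^N\mid f(x)<+\infty\}$; it is always assumed to be nonempty. $\mathbf{1}^i$ denotes the $i$th unit vector. For integer vectors $x,y$, let $x\vee y$ and $x\wedge y$ be the componentwise maximum and minimum, and $[x\wedge y,x\vee y]_{\mathbb{Z}}$ the set of integer vectors $z$ with $x\wedge y\le z\le x\vee y$ componentwise. A vector $s\in\mathbb{Z}^N$ is an $(x,y)$-increment if $s=\mathbf{1}^i$ or $s=-\mathbf{1}^i$ for some $i\in N$ and $x+s\in[x\wedge y,x\vee y]_{\mathbb{Z}}$. A function $f$ is jump M$^\natural$-convex if it satisfies (JM$^\natural$-EXC): for any $x,y\in\operatorname{dom} f$ and any $(x,y)$-increment $s$, (i) or (ii) holds: (i) $x+s\in\operatorname{dom} f$, $y-s\in\operatorname{dom} f$, and $f(x)+f(y)\ge f(x+s)+f(y-s)$; (ii) there exists an $(x+s,y)$-increment $t$ such that $x+s+t\in\operatorname{dom} f$, $y-s-t\in\operatorname{dom} f$, and $f(x)+f(y)\ge f(x+s+t)+f(y-s-t)$. For $y_k\in\mathbb{Z}^{N_k}$ and $z_k\in\mathbb{Z}^{N_0}$, $(y_k,z_k)\in\mathbb{Z}^{S_k}$ is the vector whose components on $N_k$ are those of $y_k$ and whose components on $N_0$ are those of $z_k$; similarly $(y_1,y_2)\in\mathbb{Z}^{N_1\cup N_2}$. *)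

theory Defs
  imports "HOL-Library.Extended_Real" "HOL-Library.Function_Algebras"
begin

text \<open>For a finite subset \<open>N\<close> of an arbitrary type, the lattice of integer vectors indexed by \<open>N\<close>
  is represented by the integer-valued functions that vanish outside \<open>N\<close>.  In this way the pointwise
  operations and the pointwise order on functions are the vector operations and the componentwise
  order, and \<open>{inf x y..sup x y}\<close> is the integer interval spanned by \<open>x\<close> and \<open>y\<close>.\<close>

definition int_vecs :: "'a set \<Rightarrow> ('a \<Rightarrow> int) set" where
  "int_vecs N = {x. \<forall>i. i \<notin> N \<longrightarrow> x i = 0}"

definition unit_vec :: "'a \<Rightarrow> 'a \<Rightarrow> int" where
  "unit_vec i = (\<lambda>j. if j = i then 1 else 0)"

text \<open>The vector on \<open>A \<union> B\<close> (for disjoint \<open>A\<close> and \<open>B\<close>) with the components of \<open>y\<close> on \<open>A\<close> and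
  those of \<open>z\<close> on \<open>B\<close>.\<close>

definition vec_pair :: "'a set \<Rightarrow> 'a set \<Rightarrow> ('a \<Rightarrow> int) \<Rightarrow> ('a \<Rightarrow> int) \<Rightarrow> 'a \<Rightarrow> int" where
  "vec_pair A B y z = (\<lambda>i. if i \<in> A then y i else if i \<in> B then z i else 0)"

text \<open>Functions on the integer vectors over \<open>N\<close> are total functions with values in the extended
  reals; their values outside \<open>int_vecs N\<close> are irrelevant to all notions below.\<close>

definition eff_dom :: "'a set \<Rightarrow> (('a \<Rightarrow> int) \<Rightarrow> ereal) \<Rightarrow> ('a \<Rightarrow> int) set" where
  "eff_dom N f = {x \<in> int_vecs N. f x < \<infinity>}"

definition increment :: "'a set \<Rightarrow> ('a \<Rightarrow> int) \<Rightarrow> ('a \<Rightarrow> int) \<Rightarrow> ('a \<Rightarrow> int) \<Rightarrow> bool" where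
  "increment N x y s \<longleftrightarrow>
     (\<exists>i\<in>N. s = unit_vec i \<or> s = - unit_vec i) \<and> x + s \<in> {inf x y..sup x y}"

definition JM_nat_EXC :: "'a set \<Rightarrow> (('a \<Rightarrow> int) \<Rightarrow> ereal) \<Rightarrow> bool" where
  "JM_nat_EXC N f \<longleftrightarrow>
     (\<forall>x \<in> eff_dom N f. \<forall>y \<in> eff_dom N f. \<forall>s. increment N x y s \<longrightarrow>
        (x + s \<in> eff_dom N f \<and> y - s \<in> eff_dom N f \<and> f x + f y \<ge> f (x + s) + f (y - s)) \<or>
        (\<exists>t. increment N (x + s) y t \<and>
             x + s + t \<in> eff_dom N f \<and> y - s - t \<in> eff_dom N f \<and>
             f x + f y \<ge> f (x + s + t) + f (y - s - t)))"

text \<open>The first two conjuncts express that \<open>f\<close> takes its values in the reals extended by \<open>\<infinity>\<close>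
  and that its effective domain is nonempty.\<close>

definition jump_M_nat_convex :: "'a set \<Rightarrow> (('a \<Rightarrow> int) \<Rightarrow> ereal) \<Rightarrow> bool" where
  "jump_M_nat_convex N f \<longleftrightarrow>
     (\<forall>x \<in> int_vecs N. f x \<noteq> -\<infinity>) \<and> eff_dom N f \<noteq> {} \<and> JM_nat_EXC N f"

end

theory Submission
  imports Defs
begin

text \<open>
  The composition is built up from 0-1 functions.  Given two points of the effective domain and
  near-optimal vectors on \<open>N0\<close>, only the integer box spanned by these vectors matters.
  Splitting each coordinate into as many copies as the box is long turns \<open>f1\<close> and \<open>f2\<close> into functions on
  subsets of a finite set that satisfy the same exchange property (\<open>nat_valuated_split\<close>).  Their direct
  sum satisfies it as well, and the composition arises from the direct sum by merging, for each copy of a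
  coordinate in \<open>N0\<close>, the element that stands for it in \<open>S1\<close> with the one that stands for it in \<open>S2\<close>: only the sets
  containing both or neither of the two are kept, and the minimum over the two choices is taken.

  It remains to show that merging one pair preserves the exchange property.  First, an additional element
  recording parity turns the functions into valuated even delta-matroids (\<open>even_valuated_lift\<close>), where every
  exchange involves exactly two elements.  For these, the exchange property follows from the one-sided
  exchange property of the domain and from its instances at distance four (\<open>local_to_global\<close>).
  At distance four a failing exchange leads to an infinite descent (\<open>no_descent\<close>): a modular
  weight, which influences no exchange inequality, makes all the pairs in question expensive, and exchanging the
  merged elements then produces cheaper and cheaper unbalanced sets.  The same descent proves the
  distance-four case of the lift.

  The infimum in the composition need not be attained.  As only finitely many exchanges are possible for a given
  increment, the failure of all of them would leave a positive gap, which near-optimal vectors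
  contradict.
\<close>

section \<open>Symmetric differences\<close>

text \<open>Symmetric difference, as a constant of its own so that rewriting unfolds it only on request.
  All exchange moves below replace a set \<open>X\<close> by \<open>X \<triangle> {s}\<close> or \<open>X \<triangle> {s,t}\<close>.\<close>

definition tog :: "'e set \<Rightarrow> 'e set \<Rightarrow> 'e set" (infixl "\<triangle>" 65) where
  "A \<triangle> B = (A - B) \<union> (B - A)"

lemma in_tog [simp]: "e \<in> A \<triangle> B \<longleftrightarrow> (e \<in> A) \<noteq> (e \<in> B)"
  by (auto simp: tog_def)

lemma tog_assoc: "A \<triangle> B \<triangle> C = A \<triangle> (B \<triangle> C)"
  by (auto simp: set_eq_iff)

lemma tog_commute: "A \<triangle> B = B \<triangle> A"
  by (auto simp: set_eq_iff)

lemma tog_cancel: "A \<triangle> (A \<triangle> B) = B"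
  by (auto simp: set_eq_iff)

lemma tog_disjoint: "A \<inter> B = {} \<Longrightarrow> A \<triangle> B = A \<union> B"
  by (auto simp: tog_def)

lemma tog_subset: "B \<subseteq> A \<Longrightarrow> A \<triangle> B = A - B"
  by (auto simp: tog_def)

lemma tog_right_commute: "A \<triangle> B \<triangle> C = A \<triangle> C \<triangle> B"
  by (metis tog_assoc tog_commute)

text \<open>Of the elements toggled here, exactly \<open>s\<close> and \<open>t\<close> are toggled twice.\<close>

lemma tog4:
  assumes "u \<noteq> v" "u \<noteq> j" "v \<noteq> j" "s \<notin> {u,v,j}" "t \<in> {u,v,j}"
  shows "A \<triangle> {u,v} \<triangle> {s,j} \<triangle> {s,t} = A \<triangle> ({u,v,j} - {t})"
proof -
  have "{u,v} \<triangle> ({s,j} \<triangle> {s,t}) = {u,v,j} - {t}"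
    using assms by (auto simp: tog_def)
  then show ?thesis by (simp add: tog_assoc)
qed

lemma finite_tog: "finite A \<Longrightarrow> finite B \<Longrightarrow> finite (A \<triangle> B)"
  by (simp add: tog_def)

lemma even_card_tog:
  assumes "finite A" "finite B"
  shows "even (card (A \<triangle> B)) \<longleftrightarrow> (even (card A) \<longleftrightarrow> even (card B))"
proof -
  have "card (A \<triangle> B) = card (A - B) + card (B - A)"
    unfolding tog_def using assms by (intro card_Un_disjoint) auto
  moreover have "card A = card (A - B) + card (A \<inter> B)"
    using assms by (subst card_Un_disjoint [symmetric]) (auto intro: arg_cong [where f = card])
  moreover have "card B = card (B - A) + card (A \<inter> B)"
    using assms by (subst card_Un_disjoint [symmetric]) (auto intro: arg_cong [where f = card])
  ultimately show ?thesis by presburger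
qed

section \<open>Valuated set systems\<close>

text \<open>The function \<open>F\<close>, with effective domain \<open>J\<close>, is a valuated even delta-matroid on the finite set \<open>E\<close>
  all of whose feasible sets have even cardinality.  Values of \<open>F\<close> outside \<open>J\<close> play no role and stand
  for \<open>\<infinity>\<close>.  The family \<open>J\<close> may be empty.\<close>

definition even_valuated :: "'e set \<Rightarrow> 'e set set \<Rightarrow> ('e set \<Rightarrow> real) \<Rightarrow> bool" where
  "even_valuated E J F \<longleftrightarrow> finite E \<and> J \<subseteq> Pow E \<and> (\<forall>X\<in>J. even (card X)) \<and>
     (\<forall>X\<in>J. \<forall>Y\<in>J. \<forall>s\<in>X \<triangle> Y. \<exists>t\<in>X \<triangle> Y. t \<noteq> s \<and> X \<triangle> {s,t} \<in> J \<and> Y \<triangle> {s,t} \<in> J \<and>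
        F (X \<triangle> {s,t}) + F (Y \<triangle> {s,t}) \<le> F X + F Y)"

text \<open>The 0-1 form of (JM\<open>\<natural>\<close>-EXC): there is no parity restriction, and a single element may be exchanged.\<close>

definition nat_valuated :: "'e set \<Rightarrow> 'e set set \<Rightarrow> ('e set \<Rightarrow> real) \<Rightarrow> bool" where
  "nat_valuated E J F \<longleftrightarrow> finite E \<and> J \<subseteq> Pow E \<and>
     (\<forall>X\<in>J. \<forall>Y\<in>J. \<forall>s\<in>X \<triangle> Y.
        (X \<triangle> {s} \<in> J \<and> Y \<triangle> {s} \<in> J \<and> F (X \<triangle> {s}) + F (Y \<triangle> {s}) \<le> F X + F Y) \<or>
        (\<exists>t\<in>X \<triangle> Y. t \<noteq> s \<and> X \<triangle> {s,t} \<in> J \<and> Y \<triangle> {s,t} \<in> J \<and>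
           F (X \<triangle> {s,t}) + F (Y \<triangle> {s,t}) \<le> F X + F Y))"

text \<open>Along a family with the one-sided exchange property, some exchange pair starting from \<open>A\<close>
  towards \<open>B\<close> avoids a prescribed element \<open>s\<close>.\<close>

lemma exchange_avoiding:
  assumes dom: "\<And>X Y s. \<lbrakk>X \<in> J; Y \<in> J; s \<in> X \<triangle> Y\<rbrakk> \<Longrightarrow> \<exists>t\<in>X \<triangle> Y. t \<noteq> s \<and> X \<triangle> {s,t} \<in> J"
    and A: "A \<in> J" and B: "B \<in> J" and s: "s \<in> A \<triangle> B" and card: "4 \<le> card (A \<triangle> B)"
  shows "\<exists>u\<in>A \<triangle> B - {s}. \<exists>v\<in>A \<triangle> B - {s}. u \<noteq> v \<and> A \<triangle> {u,v} \<in> J"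
proof -
  define D where "D = A \<triangle> B"
  obtain u where u: "u \<in> D" "u \<noteq> s"
    using dom [OF A B s] unfolding D_def by blast
  obtain t where t: "t \<in> D" "t \<noteq> u" "A \<triangle> {u,t} \<in> J"
    using dom [OF A B, of u] u unfolding D_def by blast
  show ?thesis
  proof (cases "t = s")
    case False
    then show ?thesis using u t unfolding D_def [symmetric]
      by (metis DiffI singletonD)
  next
    case True
    define A2 where "A2 = A \<triangle> {u,s}"
    have A2: "A2 \<in> J" using t True by (simp add: A2_def)
    have A2B: "A2 \<triangle> B = D - {u,s}"
      using u s by (simp add: A2_def tog_right_commute D_def [symmetric] tog_subset)
    have "card D - card {u,s} \<le> card (D - {u,s})"
      by (rule diff_card_le_card_Diff) simp
    then have "0 < card (D - {u,s})" using u card by (simp add: D_def)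
    then obtain w where w: "w \<in> A2 \<triangle> B" unfolding A2B card_gt_0_iff by blast
    obtain x where x: "x \<in> A2 \<triangle> B" "x \<noteq> w" "A2 \<triangle> {w,x} \<in> J"
      using dom [OF A2 B w] by blast
    note wx = w [unfolded A2B] x(1) [unfolded A2B]
    have d: "A2 \<triangle> {w,x} \<triangle> A = {u,s} \<union> {w,x}"
    proof -
      have "A2 \<triangle> {w,x} \<triangle> A = A \<triangle> A2 \<triangle> {w,x}"
        by (metis tog_assoc tog_commute)
      also have "\<dots> = {u,s} \<triangle> {w,x}" by (simp add: A2_def tog_cancel)
      also have "\<dots> = {u,s} \<union> {w,x}" using wx by (intro tog_disjoint) simp
      finally show ?thesis .
    qed
    obtain r where r: "r \<in> {u,s} \<union> {w,x}" "r \<noteq> s" "A2 \<triangle> {w,x} \<triangle> {s,r} \<in> J"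
      using dom [OF x(3) A, of s] unfolding d by blast
    have "A \<triangle> {w,x} \<triangle> {s,u} \<triangle> {s,r} = A \<triangle> ({w,x,u} - {r})"
      by (rule tog4) (use wx x(2) u r in auto)
    then have "A \<triangle> ({w,x,u} - {r}) \<in> J"
      using r(3) unfolding A2_def insert_commute [of u s] tog_right_commute [of A "{s,u}"] by simp
    moreover have "{w,x,u} - {r} = {x,u} \<or> {w,x,u} - {r} = {w,u} \<or> {w,x,u} - {r} = {w,x}"
    proof -
      have "r = w \<or> r = x \<or> r = u" using r(1,2) by blast
      moreover have "w \<noteq> x" "w \<noteq> u" "x \<noteq> u" using wx x(2) by simp_all
      ultimately show ?thesis by (elim disjE) (simp_all add: insert_Diff_if)
    qed
    ultimately have "A \<triangle> {x,u} \<in> J \<or> A \<triangle> {w,u} \<in> J \<or> A \<triangle> {w,x} \<in> J" by metis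
    moreover have "w \<in> D - {s}" "x \<in> D - {s}" "u \<in> D - {s}" "w \<noteq> x" "w \<noteq> u" "x \<noteq> u"
      using wx x(2) u by simp_all
    ultimately show ?thesis unfolding D_def [symmetric] by metis
  qed
qed

text \<open>For a family with the one-sided exchange property it suffices to check the valuated exchange
  between sets at distance four.  In a counterexample \<open>(A, B, s)\<close> of minimal distance, a modular weight \<open>p\<close>
  makes every \<open>A \<triangle> {s,j}\<close> at least as expensive as \<open>A\<close> and every \<open>B \<triangle> {s,j}\<close> strictly more expensive
  than \<open>B\<close>.  Let \<open>C = A \<triangle> {u,v}\<close> have minimal weighted value among the pairs avoiding \<open>s\<close>.  The exchange of \<open>s\<close>
  between \<open>C\<close> and \<open>B\<close>, which are closer, yields a set \<open>C \<triangle> {s,j}\<close> strictly cheaper than \<open>C\<close>; the exchange at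
  distance four between \<open>A\<close> and that set contradicts the choice of \<open>C\<close>.\<close>

lemma local_to_global:
  assumes fin: "finite E" and JE: "J \<subseteq> Pow E" and ev: "\<And>X. X \<in> J \<Longrightarrow> even (card X)"
    and dom: "\<And>X Y s. \<lbrakk>X \<in> J; Y \<in> J; s \<in> X \<triangle> Y\<rbrakk> \<Longrightarrow> \<exists>t\<in>X \<triangle> Y. t \<noteq> s \<and> X \<triangle> {s,t} \<in> J"
    and loc: "\<And>X Y s. \<lbrakk>X \<in> J; Y \<in> J; s \<in> X \<triangle> Y; card (X \<triangle> Y) = 4\<rbrakk> \<Longrightarrow>
       \<exists>t\<in>X \<triangle> Y. t \<noteq> s \<and> X \<triangle> {s,t} \<in> J \<and> Y \<triangle> {s,t} \<in> J \<and>
        F (X \<triangle> {s,t}) + F (Y \<triangle> {s,t}) \<le> F X + (F Y :: real)"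
  shows "even_valuated E J F"
proof -
  have "\<exists>t\<in>A \<triangle> B. t \<noteq> s \<and> A \<triangle> {s,t} \<in> J \<and> B \<triangle> {s,t} \<in> J \<and>
        F (A \<triangle> {s,t}) + F (B \<triangle> {s,t}) \<le> F A + F B"
    if "A \<in> J" "B \<in> J" "s \<in> A \<triangle> B" for A B s
    using that
  proof (induction "card (A \<triangle> B)" arbitrary: A B s rule: less_induct)
    case less
    note A = \<open>A \<in> J\<close> and B = \<open>B \<in> J\<close> and s = \<open>s \<in> A \<triangle> B\<close>
    define D where "D = A \<triangle> B"
    have sD: "s \<in> D" using s by (simp add: D_def)
    have finJ: "finite X" if "X \<in> J" for X
      using that JE fin by (meson PowD finite_subset subset_iff)
    have finD: "finite D" using A B finJ by (simp add: D_def finite_tog)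
    have BD: "B = A \<triangle> D" by (simp add: D_def tog_cancel)
    have evD: "even (card D)"
      using A B finJ ev by (simp add: D_def even_card_tog)
    obtain t0 where t0: "t0 \<in> D" "t0 \<noteq> s" using dom [OF A B s] unfolding D_def [symmetric] by blast
    have "card {s,t0} \<le> card D" by (rule card_mono) (use finD sD t0 in auto)
    then have "2 \<le> card D" using t0(2) by simp
    with evD have "card D = 2 \<or> card D = 4 \<or> 6 \<le> card D" by presburger
    then consider "card D = 2" | "card D = 4" | "card D \<ge> 6" by blast
    then show ?case
    proof cases
      case 1
      then have "D = {s,t0}"
        using card_subset_eq [OF finD, of "{s,t0}"] sD t0 by auto
      then have "A \<triangle> {s,t0} = B" "B \<triangle> {s,t0} = A"
        by (metis D_def tog_cancel, metis D_def tog_cancel tog_commute)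
      then show ?thesis using t0 A B by (auto simp: D_def)
    next
      case 2
      then show ?thesis using loc [OF A B s] by (simp add: D_def)
    next
      case 3
      show ?thesis
      proof (rule ccontr)
        assume "\<not> ?thesis"
        then have fail: "F A + F B < F (A \<triangle> {s,j}) + F (B \<triangle> {s,j})"
          if "j \<in> D" "j \<noteq> s" "A \<triangle> {s,j} \<in> J" "B \<triangle> {s,j} \<in> J" for j
          using that unfolding D_def [symmetric] by (meson not_le)
        \<comment> \<open>The weights that separate the failing pairs: equality on the side of \<open>A\<close> where possible.\<close>
        have "\<forall>j\<in>D - {s}. \<exists>q. (A \<triangle> {s,j} \<in> J \<longrightarrow> F A \<le> F (A \<triangle> {s,j}) + q) \<and>
            (B \<triangle> {s,j} \<in> J \<longrightarrow> F B < F (B \<triangle> {s,j}) - q)"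
        proof
          fix j assume j: "j \<in> D - {s}"
          show "\<exists>q. (A \<triangle> {s,j} \<in> J \<longrightarrow> F A \<le> F (A \<triangle> {s,j}) + q) \<and>
            (B \<triangle> {s,j} \<in> J \<longrightarrow> F B < F (B \<triangle> {s,j}) - q)"
          proof (cases "A \<triangle> {s,j} \<in> J")
            case True
            then show ?thesis using fail [of j] j
              by (intro exI [of _ "F A - F (A \<triangle> {s,j})"]) auto
          next
            case False
            then show ?thesis
              by (intro exI [of _ "F (B \<triangle> {s,j}) - F B - 1"]) auto
          qed
        qed
        then obtain p where p:
          "\<And>j. \<lbrakk>j \<in> D; j \<noteq> s; A \<triangle> {s,j} \<in> J\<rbrakk> \<Longrightarrow> F A \<le> F (A \<triangle> {s,j}) + p j"
          "\<And>j. \<lbrakk>j \<in> D; j \<noteq> s; B \<triangle> {s,j} \<in> J\<rbrakk> \<Longrightarrow> F B < F (B \<triangle> {s,j}) - p j"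
          unfolding Ball_def Diff_iff singleton_iff by (metis (no_types))
        define Q where "Q = {(u,v). u \<in> D - {s} \<and> v \<in> D - {s} \<and> u \<noteq> v \<and> A \<triangle> {u,v} \<in> J}"
        have finQ: "finite Q"
          by (rule finite_subset [of _ "D \<times> D"]) (use finD in \<open>auto simp: Q_def\<close>)
        have "\<exists>u\<in>D - {s}. \<exists>v\<in>D - {s}. u \<noteq> v \<and> A \<triangle> {u,v} \<in> J"
          unfolding D_def
        proof (rule exchange_avoiding [OF dom A B s])
          show "4 \<le> card (A \<triangle> B)" using 3 by (simp add: D_def)
        qed
        then have "Q \<noteq> {}" by (auto simp: Q_def)
        define \<Phi> where "\<Phi> = (\<lambda>(u,v). F (A \<triangle> {u,v}) + p u + p v)"
        obtain u v where uvQ: "(u,v) \<in> Q" and min: "\<And>u' v'. (u',v') \<in> Q \<Longrightarrow> \<Phi> (u,v) \<le> \<Phi> (u',v')"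
        proof -
          have "Min (\<Phi> ` Q) \<in> \<Phi> ` Q" using finQ \<open>Q \<noteq> {}\<close> by (intro Min_in) auto
          then obtain q where q: "q \<in> Q" "\<Phi> q = Min (\<Phi> ` Q)" by auto
          have "\<Phi> q \<le> \<Phi> q'" if "q' \<in> Q" for q'
            unfolding q(2) using finQ that by (intro Min_le) auto
          then show thesis using that [of "fst q" "snd q"] q(1) by simp
        qed
        define C where "C = A \<triangle> {u,v}"
        have uv: "u \<in> D" "v \<in> D" "u \<noteq> s" "v \<noteq> s" "u \<noteq> v" and C: "C \<in> J"
          using uvQ by (auto simp: Q_def C_def)
        have CB: "C \<triangle> B = D - {u,v}"
          using uv unfolding C_def by (simp add: tog_right_commute D_def [symmetric] tog_subset)
        have "card (C \<triangle> B) < card (A \<triangle> B)"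
          unfolding CB D_def [symmetric] using uv finD by (intro psubset_card_mono) auto
        from less.hyps [OF this C B, of s] obtain j where j: "j \<in> D" "j \<notin> {u,v,s}"
            "C \<triangle> {s,j} \<in> J" "B \<triangle> {s,j} \<in> J" "F (C \<triangle> {s,j}) + F (B \<triangle> {s,j}) \<le> F C + F B"
          unfolding CB using uv sD by blast
        have lt: "F (C \<triangle> {s,j}) + p j < F C" using p(2) [of j] j by auto
        have d: "A \<triangle> (C \<triangle> {s,j}) = {u,v,s,j}"
          using uv j by (simp add: C_def tog_assoc tog_cancel tog_disjoint) blast
        have "card {u,v,s,j} = 4" using uv j by auto
        from loc [OF A j(3), of s, unfolded d, OF _ this] obtain t where t: "t \<in> {u,v,j}"
            "A \<triangle> {s,t} \<in> J" "C \<triangle> {s,j} \<triangle> {s,t} \<in> J"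
            "F (A \<triangle> {s,t}) + F (C \<triangle> {s,j} \<triangle> {s,t}) \<le> F A + F (C \<triangle> {s,j})"
          by auto
        have pt: "F A \<le> F (A \<triangle> {s,t}) + p t" using p(1) [of t] t uv j by auto
        have C4: "C \<triangle> {s,j} \<triangle> {s,t} = A \<triangle> ({u,v,j} - {t})"
          using uv j t(1) unfolding C_def by (intro tog4) auto
        have nj: "v \<noteq> j" "u \<noteq> j" "j \<noteq> s" using j by auto
        have minC: "F C + p u + p v \<le> F (A \<triangle> {x,y}) + p x + p y"
          if "x \<in> D - {s}" "y \<in> D - {s}" "x \<noteq> y" "A \<triangle> {x,y} \<in> J" for x y
          using min [of x y] that by (simp add: Q_def \<Phi>_def C_def)
        have key: "F C + p u + p v \<le> F (C \<triangle> {s,j} \<triangle> {s,t}) + (p u + p v + p j - p t)"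
        proof -
          consider "t = u" "{u,v,j} - {t} = {v,j}" | "t = v" "{u,v,j} - {t} = {u,j}"
            | "t = j" "{u,v,j} - {t} = {u,v}"
            using t(1) uv j by (auto simp: insert_Diff_if)
          then show ?thesis
          proof cases
            case 1
            then show ?thesis using minC [of v j] t(3) uv j(1) nj unfolding C4 by simp
          next
            case 2
            then show ?thesis using minC [of u j] t(3) uv j(1) nj unfolding C4 by simp
          next
            case 3
            then show ?thesis using minC [of u v] t(3) uv j(1) nj unfolding C4 by simp
          qed
        qed
        show False using lt pt key t(4) by linarith
      qed
    qed
  qed
  then show ?thesis using fin JE ev unfolding even_valuated_def by blast
qed

section \<open>A descent on the pairs of a four-element set\<close>

text \<open>An antisymmetric function on the pairs of a four-element set is a sum of vertex potentials: the six
  values have three degrees of freedom, and half the sum over the pairs at a vertex is a potential.\<close>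

lemma pair_potential:
  fixes c :: "'e set \<Rightarrow> real"
  assumes "card V = 4" and anti: "\<And>i j. \<lbrakk>i \<in> V; j \<in> V; i \<noteq> j\<rbrakk> \<Longrightarrow> c (V - {i,j}) = - c {i,j}"
  shows "\<exists>p. \<forall>i\<in>V. \<forall>j\<in>V. i \<noteq> j \<longrightarrow> p i + p j = c {i,j}"
proof -
  obtain q r s t where V: "V = {q,r,s,t}" and d: "distinct [q,r,s,t]"
    using assms(1) by (auto simp: card_Suc_eq numeral_eq_Suc)
  have c: "c {s,t} = - c {q,r}" "c {r,t} = - c {q,s}" "c {r,s} = - c {q,t}"
    using anti [of q r] anti [of q s] anti [of q t] d
    by (auto simp: V insert_Diff_if)
  define p where "p = (\<lambda>i. (\<Sum>j\<in>V - {i}. c {i,j}) / 2)"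
  have "p q = (c {q,r} + c {q,s} + c {q,t}) / 2" "p r = (c {q,r} + c {r,s} + c {r,t}) / 2"
    "p s = (c {q,s} + c {r,s} + c {s,t}) / 2" "p t = (c {q,t} + c {r,t} + c {s,t}) / 2"
    using d by (auto simp: p_def V insert_Diff_if insert_commute)
  then show ?thesis
    using c by (intro exI [of _ p]) (auto simp: V insert_commute field_simps)
qed

text \<open>The core of the argument.  Think of \<open>h i\<close> and \<open>k j\<close> as values of sets that are one single exchange away
  from two sets \<open>X\<close> and \<open>Y\<close> with \<open>X \<triangle> Y = V\<close> and values \<open>A1\<close> and \<open>A2\<close>, and of \<open>G Z\<close> as the value of \<open>X \<triangle> Z\<close>.
  If no complementary pair \<open>{i,j}\<close>, \<open>V - {i,j}\<close> has total value at most \<open>A1 + A2\<close>, then a modular weight makes all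
  pairs cost more than the average of \<open>A1\<close> and \<open>A2\<close>.  After this weighting and a constant
  shift of \<open>k\<close>, each value \<open>k j\<close> exceeds some \<open>h i\<close>
  and each value \<open>h j\<close> exceeds some \<open>k i\<close>, which is impossible in a finite nonempty set of reals.\<close>

lemma no_descent:
  fixes h k :: "'e \<Rightarrow> real" and G :: "'e set \<Rightarrow> real"
  assumes V: "card V = 4" and sub: "H \<subseteq> V" "K \<subseteq> V" and ne: "H \<union> K \<noteq> {}"
    and down: "\<And>j. j \<in> K \<Longrightarrow> \<exists>i\<in>H. i \<noteq> j \<and> V - {i,j} \<in> P \<and> h i + G (V - {i,j}) \<le> A1 + k j"
    and up: "\<And>j. j \<in> H \<Longrightarrow> \<exists>i\<in>K. i \<noteq> j \<and> {i,j} \<in> P \<and> k i + G {i,j} \<le> A2 + h j"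
    and gap: "\<And>i j. \<lbrakk>i \<in> V; j \<in> V; i \<noteq> j; {i,j} \<in> P; V - {i,j} \<in> P\<rbrakk> \<Longrightarrow> A1 + A2 < G {i,j} + G (V - {i,j})"
  shows False
proof -
  define A where "A = (A1 + A2) / 2"
  define W where "W = {X. X \<subseteq> V \<and> card X = 2}"
  have finV: "finite V" using V by (simp add: card_ge_0_finite)
  have W: "V - X \<in> W" "V - (V - X) = X" if "X \<in> W" for X
    using that V finV by (auto simp: W_def card_Diff_subset finite_subset)
  have pairW: "{i,j} \<in> W" if "i \<in> V" "j \<in> V" "i \<noteq> j" for i j
    using that by (auto simp: W_def)
  have "\<forall>X\<in>W. \<exists>d. (X \<in> P \<longrightarrow> d < G X - A) \<and> (V - X \<in> P \<longrightarrow> - d < G (V - X) - A)"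
  proof
    fix X assume "X \<in> W"
    then obtain i j where ij: "X = {i,j}" "i \<noteq> j" "i \<in> V" "j \<in> V"
      by (auto simp: W_def card_2_iff)
    show "\<exists>d. (X \<in> P \<longrightarrow> d < G X - A) \<and> (V - X \<in> P \<longrightarrow> - d < G (V - X) - A)"
    proof (cases "X \<in> P \<and> V - X \<in> P")
      case True
      then have "A1 + A2 < G X + G (V - X)"
        using gap [OF ij(3,4,2)] unfolding ij(1) by blast
      then have "A - G (V - X) < G X - A"
        unfolding A_def by (simp add: field_simps)
      then obtain d where "A - G (V - X) < d" "d < G X - A" using dense by blast
      then show ?thesis by (intro exI [of _ d]) auto
    next
      case False
      then show ?thesis
      proof (cases "X \<in> P")
        case True
        with False show ?thesis by (intro exI [of _ "G X - A - 1"]) simp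
      next
        case False
        then show ?thesis by (intro exI [of _ "A - G (V - X) + 1"]) simp
      qed
    qed
  qed
  then obtain d where d: "\<And>X. X \<in> W \<Longrightarrow> X \<in> P \<Longrightarrow> d X < G X - A"
    "\<And>X. X \<in> W \<Longrightarrow> V - X \<in> P \<Longrightarrow> - d X < G (V - X) - A" by metis
  \<comment> \<open>Averaging makes the separating values antisymmetric under complementation.\<close>
  define c where "c = (\<lambda>X. (d X - d (V - X)) / 2)"
  have c: "c X < G X - A" if "X \<in> W" "X \<in> P" for X
    using d(1) [OF that] d(2) [of "V - X"] W [OF that(1)] that by (auto simp: c_def)
  have anti: "c (V - X) = - c X" if "X \<in> W" for X
    using W [OF that] by (simp add: c_def field_simps)
  obtain p where p: "\<And>i j. \<lbrakk>i \<in> V; j \<in> V; i \<noteq> j\<rbrakk> \<Longrightarrow> p i + p j = c {i,j}"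
    using pair_potential [OF V, of c] anti pairW by metis
  define a where "a = (\<lambda>i. h i - p i)"
  define b where "b = (\<lambda>j. k j + (A1 - A2) / 2 + p j)"
  have ab: "\<exists>i\<in>H. a i < b j" if j: "j \<in> K" for j
  proof -
    obtain i where i: "i \<in> H" "i \<noteq> j" "V - {i,j} \<in> P" "h i + G (V - {i,j}) \<le> A1 + k j"
      using down [OF j] by blast
    have ij: "i \<in> V" "j \<in> V" using i j sub by auto
    have "- (p i + p j) < G (V - {i,j}) - A"
      using c [OF W(1) i(3)] anti pairW ij i p by metis
    then have "a i < b j" using i(4) by (simp add: a_def b_def A_def field_simps)
    then show ?thesis using i by blast
  qed
  have ba: "\<exists>i\<in>K. b i < a j" if j: "j \<in> H" for j
  proof -
    obtain i where i: "i \<in> K" "i \<noteq> j" "{i,j} \<in> P" "k i + G {i,j} \<le> A2 + h j"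
      using up [OF j] by blast
    have ij: "i \<in> V" "j \<in> V" using i j sub by auto
    have "p i + p j < G {i,j} - A"
      using c [OF _ i(3)] pairW ij i p by metis
    then have "b i < a j" using i(4) by (simp add: a_def b_def A_def field_simps)
    then show ?thesis using i by blast
  qed
  have "finite (a ` H \<union> b ` K)" using sub finV by (auto intro: finite_subset)
  from ex_min_if_finite [OF this] ne obtain m where m: "m \<in> a ` H \<union> b ` K"
    "\<not> (\<exists>x\<in>a ` H \<union> b ` K. x < m)" by auto
  then show False using ab ba by blast
qed

section \<open>The parity element\<close>

lemma tog_compl: "W \<subseteq> X \<triangle> Y \<Longrightarrow> Y \<triangle> W = X \<triangle> (X \<triangle> Y - W)"
  by (metis tog_subset tog_assoc tog_cancel)

text \<open>At distance four every pair either contains \<open>s\<close> or is the complement of a pair containing \<open>s\<close>, so a failure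
  of the exchange at one element is a failure at all of them.\<close>

lemma gap_from_failure:
  fixes F :: "'e set \<Rightarrow> real"
  assumes card: "card (X \<triangle> Y) = 4" and s: "s \<in> X \<triangle> Y"
    and fail: "\<And>t. \<lbrakk>t \<in> X \<triangle> Y; t \<noteq> s; X \<triangle> {s,t} \<in> J; Y \<triangle> {s,t} \<in> J\<rbrakk> \<Longrightarrow>
      F X + F Y < F (X \<triangle> {s,t}) + F (Y \<triangle> {s,t})"
    and ij: "i \<in> X \<triangle> Y" "j \<in> X \<triangle> Y" "i \<noteq> j"
    and J: "X \<triangle> {i,j} \<in> J" "X \<triangle> (X \<triangle> Y - {i,j}) \<in> J"
  shows "F X + F Y < F (X \<triangle> {i,j}) + F (X \<triangle> (X \<triangle> Y - {i,j}))"
proof -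
  define V where "V = X \<triangle> Y"
  have compl: "Y \<triangle> W = X \<triangle> (V - W)" if "W \<subseteq> V" for W
    using tog_compl that unfolding V_def .
  note s' = s [folded V_def] and ij' = ij [folded V_def] and J' = J [folded V_def]
    and fail' = fail [folded V_def]
  have finV: "finite V" using card unfolding V_def by (simp add: card_ge_0_finite)
  show ?thesis
  proof (cases "s \<in> {i,j}")
    case True
    then obtain t where t: "t \<in> V" "t \<noteq> s" "{i,j} = {s,t}" using ij' by blast
    have "Y \<triangle> {s,t} = X \<triangle> (V - {s,t})" using t s' by (intro compl) simp
    then show ?thesis using fail' [of t] J' t unfolding t(3) V_def [symmetric] by simp
  next
    case False
    have "card (V - {i,j}) = 2" using card ij' finV by (simp add: V_def card_Diff_subset)
    moreover have "s \<in> V - {i,j}" using s' False by simp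
    ultimately have "card (V - {i,j} - {s}) = 1" using finV by simp
    then obtain t where "V - {i,j} - {s} = {t}" by (rule card_1_singletonE)
    then have t: "V - {i,j} = {s,t}" "t \<noteq> s" using \<open>s \<in> V - {i,j}\<close> by blast+
    have tV: "t \<in> V" using t(1) by blast
    have "Y \<triangle> {s,t} = X \<triangle> (V - {s,t})" using tV s' by (intro compl) simp
    moreover have "V - {s,t} = {i,j}" unfolding t(1) [symmetric] using ij' by blast
    ultimately show ?thesis
      using fail' [of t] J' t tV unfolding t(1) V_def [symmetric] by simp
  qed
qed

lemma nat_valuatedE:
  assumes "nat_valuated E J F" "X \<in> J" "Y \<in> J" "s \<in> X \<triangle> Y"
  obtains (single) "X \<triangle> {s} \<in> J" "Y \<triangle> {s} \<in> J" "F (X \<triangle> {s}) + F (Y \<triangle> {s}) \<le> F X + F Y"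
  | (double) t where "t \<in> X \<triangle> Y" "t \<noteq> s" "X \<triangle> {s,t} \<in> J" "Y \<triangle> {s,t} \<in> J"
      "F (X \<triangle> {s,t}) + F (Y \<triangle> {s,t}) \<le> F X + F Y"
  using assms unfolding nat_valuated_def by blast

lemma even_valuatedE:
  assumes "even_valuated E J F" "X \<in> J" "Y \<in> J" "s \<in> X \<triangle> Y"
  obtains t where "t \<in> X \<triangle> Y" "t \<noteq> s" "X \<triangle> {s,t} \<in> J" "Y \<triangle> {s,t} \<in> J"
      "F (X \<triangle> {s,t}) + F (Y \<triangle> {s,t}) \<le> F X + F Y"
  using assms unfolding even_valuated_def by blast

text \<open>At distance three an exchanged pair is the complement of a single element, which makes a single
  exchange always available.\<close>

lemma three_exchange:
  assumes nv: "nat_valuated E J F" and X: "X \<in> J" and Y: "Y \<in> J" and card: "card (X \<triangle> Y) = 3"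
  obtains i where "i \<in> X \<triangle> Y" "X \<triangle> {i} \<in> J" "Y \<triangle> {i} \<in> J" "F (X \<triangle> {i}) + F (Y \<triangle> {i}) \<le> F X + F Y"
proof -
  define V where "V = X \<triangle> Y"
  have finV: "finite V" using card unfolding V_def by (simp add: card_ge_0_finite)
  obtain s where s: "s \<in> V" using card unfolding V_def [symmetric] by fastforce
  from nv X Y s [unfolded V_def] show thesis
  proof (cases rule: nat_valuatedE)
    case single
    then show thesis using that s unfolding V_def by blast
  next
    case (double t)
    note t = double(1) [folded V_def]
    have "card (V - {s,t}) = 1"
      using card s t double(2) finV by (simp add: V_def card_Diff_subset)
    then obtain r where r: "V - {s,t} = {r}" by (rule card_1_singletonE)
    have sub: "{s,t} \<subseteq> V" using s t by simp
    have 1: "Y \<triangle> {s,t} = X \<triangle> {r}" using tog_compl [of "{s,t}" X Y] sub r unfolding V_def by simp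
    have 2: "X \<triangle> {s,t} = Y \<triangle> {r}"
      using tog_compl [of "{s,t}" Y X] sub r unfolding V_def tog_commute [of Y X] by simp
    have "r \<in> V" using r by blast
    then show thesis using that [of r] double(3-5) unfolding 1 2 V_def by linarith
  qed
qed

text \<open>Iterated exchange would only lead to some set closer to \<open>Y\<close>; the sets obtained inductively are at
  distance three from \<open>X\<close>, where the previous lemma applies.\<close>

lemma single_step:
  assumes nv: "nat_valuated E J F" and "X \<in> J" "Y \<in> J" "odd (card (X \<triangle> Y))"
  shows "\<exists>t\<in>X \<triangle> Y. X \<triangle> {t} \<in> J"
  using assms(2-)
proof (induction "card (X \<triangle> Y)" arbitrary: X rule: less_induct)
  case less
  define V where "V = X \<triangle> Y"
  have finV: "finite V" using less.prems(3) unfolding V_def [symmetric]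
    by (cases "finite V") simp_all
  obtain s where s: "s \<in> V" using less.prems(3) unfolding V_def [symmetric] by fastforce
  from nv less.prems(1,2) s [unfolded V_def] show ?case
  proof (cases rule: nat_valuatedE)
    case single
    then show ?thesis using s unfolding V_def by blast
  next
    case (double t)
    note t = double(1) [folded V_def]
    define Z where "Z = X \<triangle> {s,t}"
    have Z: "Z \<in> J" using double(3) by (simp add: Z_def)
    have ZY: "Z \<triangle> Y = V - {s,t}"
      unfolding Z_def tog_right_commute [of X _ Y] V_def [symmetric] using s t by (simp add: tog_subset)
    have c: "card V = card (Z \<triangle> Y) + 2"
    proof -
      have "card V = card (V - {s,t}) + card {s,t}"
        using s t finV by (metis card_Diff_subset card_mono empty_subsetI finite.emptyI finite.insertI insert_subset le_add_diff_inverse2)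
      then show ?thesis unfolding ZY using double(2) by simp
    qed
    have "odd (card (Z \<triangle> Y))" using less.prems(3) c unfolding V_def by simp
    moreover have "card (Z \<triangle> Y) < card (X \<triangle> Y)" using c unfolding V_def by simp
    ultimately obtain r where r: "r \<in> V - {s,t}" "Z \<triangle> {r} \<in> J"
      using less.hyps [of Z] Z less.prems(2) unfolding ZY by blast
    have XW: "X \<triangle> (Z \<triangle> {r}) = {s,t,r}"
    proof -
      have "X \<triangle> (Z \<triangle> {r}) = {s,t} \<triangle> {r}" by (simp add: Z_def tog_assoc tog_cancel)
      also have "\<dots> = {s,t} \<union> {r}" using r by (intro tog_disjoint) simp
      finally show ?thesis by blast
    qed
    have "card (X \<triangle> (Z \<triangle> {r})) = 3" unfolding XW using r double(2) by auto
    from three_exchange [OF nv less.prems(1) r(2) this] obtain i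
      where "i \<in> {s,t,r}" "X \<triangle> {i} \<in> J" unfolding XW by metis
    then show ?thesis using s t r unfolding V_def [symmetric] by blast
  qed
qed

text \<open>The extra element \<open>None\<close> records parity: a feasible set is completed by \<open>None\<close> exactly if its
  cardinality is odd.\<close>

definition lift_dom :: "'e set \<Rightarrow> 'e set set \<Rightarrow> 'e option set set" where
  "lift_dom E J = {X. X \<subseteq> insert None (Some ` E) \<and> even (card X) \<and> Some -` X \<in> J}"

lemma vimage_tog: "f -` (X \<triangle> Y) = f -` X \<triangle> f -` Y"
  by (simp add: tog_def vimage_Un vimage_Diff)

lemma card_Some_vimage:
  assumes "finite X"
  shows "card X = card (Some -` X) + (if None \<in> X then 1 else 0)"
proof -
  have eq: "X - {None} = Some ` (Some -` X)"
  proof (intro set_eqI iffI)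
    fix e assume "e \<in> X - {None}"
    then show "e \<in> Some ` (Some -` X)" by (cases e) auto
  qed auto
  have "card (X - {None}) = card (Some -` X)"
    unfolding eq by (rule card_image) simp
  then show ?thesis using assms by (simp add: card_Diff_singleton_if card_gt_0_iff split: if_splits) (metis Suc_pred card_gt_0_iff empty_iff)
qed

text \<open>Single exchanges become exchanges of a pair with \<open>None\<close>.  The content is that between sets at even
  distance no single exchange is needed; at distance four this is the descent argument applied to the
  values \<open>h i = F (x \<triangle> {i})\<close> and \<open>k j = F (y \<triangle> {j})\<close>.\<close>

lemma even_valuated_lift:
  assumes nv: "nat_valuated E J F"
  shows "even_valuated (insert None (Some ` E)) (lift_dom E J) (\<lambda>X. F (Some -` X))"
proof (rule local_to_global)
  have finE: "finite E" and JE: "J \<subseteq> Pow E" using nv by (auto simp: nat_valuated_def)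
  let ?U = "insert None (Some ` E)"
  let ?L = "lift_dom E J"
  show finU: "finite ?U" using finE by simp
  show "?L \<subseteq> Pow ?U" by (auto simp: lift_dom_def)
  show "even (card X)" if "X \<in> ?L" for X using that by (simp add: lift_dom_def)
  have fin: "finite X" if "X \<in> ?L" for X
    using that finU finite_subset by (auto simp: lift_dom_def)
  have L: "X \<triangle> {e,e'} \<in> ?L" if "X \<in> ?L" "e \<in> ?U" "e' \<in> ?U" "e \<noteq> e'" "Some -` X \<triangle> Some -` {e,e'} \<in> J"
    for X e e'
  proof -
    have "even (card (X \<triangle> {e,e'}))"
      using that fin [of X] by (simp add: even_card_tog lift_dom_def)
    moreover have "X \<triangle> {e,e'} \<subseteq> ?U" using that(1-3) unfolding tog_def lift_dom_def by blast
    ultimately show ?thesis using that(5) unfolding lift_dom_def by (simp add: vimage_tog)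
  qed
  have SN: "Some -` {None, Some i} = {i}" "Some -` {Some i, None} = {i}" "Some -` {Some i, Some j} = {i,j}" for i j :: 'a
    by auto
  have sub: "X \<triangle> Y \<subseteq> ?U" if "X \<in> ?L" "Y \<in> ?L" for X Y
    using that unfolding tog_def lift_dom_def by blast
  have card: "card (X \<triangle> Y) = card (Some -` X \<triangle> Some -` Y) + (if None \<in> X \<triangle> Y then 1 else 0)"
    "even (card (X \<triangle> Y))" if "X \<in> ?L" "Y \<in> ?L" for X Y
  proof -
    show "card (X \<triangle> Y) = card (Some -` X \<triangle> Some -` Y) + (if None \<in> X \<triangle> Y then 1 else 0)"
      using card_Some_vimage [of "X \<triangle> Y"] finite_tog [OF fin fin] that by (simp add: vimage_tog)
    have "even (card X)" "even (card Y)" using that by (simp_all add: lift_dom_def)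
    then show "even (card (X \<triangle> Y))"
      using fin [OF that(1)] fin [OF that(2)] by (simp add: even_card_tog)
  qed
  { fix X Y e assume X: "X \<in> ?L" and Y: "Y \<in> ?L" and e: "e \<in> X \<triangle> Y"
    define x y where "x = Some -` X" and "y = Some -` Y"
    have x: "x \<in> J" and y: "y \<in> J" using X Y by (auto simp: x_def y_def lift_dom_def)
    note cardxy = card [OF X Y, folded x_def y_def]
    have finxy: "finite (x \<triangle> y)"
      unfolding x_def y_def using fin [OF X] fin [OF Y] by (simp add: finite_tog finite_vimageI)
    have lX: "X \<triangle> {a,b} \<in> ?L" if "a \<in> X \<triangle> Y" "b \<in> X \<triangle> Y" "a \<noteq> b" "x \<triangle> Some -` {a,b} \<in> J" for a b
      using L [OF X _ _ that(3) that(4) [unfolded x_def]] that sub [OF X Y] by blast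
    have lY: "Y \<triangle> {a,b} \<in> ?L" if "a \<in> X \<triangle> Y" "b \<in> X \<triangle> Y" "a \<noteq> b" "y \<triangle> Some -` {a,b} \<in> J" for a b
      using L [OF Y _ _ that(3) that(4) [unfolded y_def]] that sub [OF X Y] by blast
    have Smem: "Some i \<in> X \<triangle> Y \<longleftrightarrow> i \<in> x \<triangle> y" for i by (simp add: x_def y_def)
    show "\<exists>t\<in>X \<triangle> Y. t \<noteq> e \<and> X \<triangle> {e,t} \<in> ?L"
    proof (cases e)
      case None
      then have "odd (card (x \<triangle> y))" using cardxy e by simp
      then obtain t where t: "t \<in> x \<triangle> y" "x \<triangle> {t} \<in> J" using single_step [OF nv x y] by blast
      have "X \<triangle> {e, Some t} \<in> ?L" using t e None by (intro lX) (simp_all only: SN Smem, simp)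
      then show ?thesis using t(1) None by (intro bexI [of _ "Some t"]) (simp, simp only: Smem)
    next
      case (Some i)
      then have i: "i \<in> x \<triangle> y" using e by (simp only: Smem)
      have l1: "\<exists>t\<in>X \<triangle> Y. t \<noteq> e \<and> X \<triangle> {e,t} \<in> ?L"
        if "t \<in> x \<triangle> y" "t \<noteq> i" "x \<triangle> {i,t} \<in> J" for t
      proof -
        have "X \<triangle> {e, Some t} \<in> ?L" using that e Some by (intro lX) (simp_all only: SN Smem, simp)
        then show ?thesis using that Some by (intro bexI [of _ "Some t"]) (simp, simp only: Smem)
      qed
      from nv x y i show ?thesis
      proof (cases rule: nat_valuatedE)
        case single
        show ?thesis
        proof (cases "None \<in> X \<triangle> Y")
          case True
          have "X \<triangle> {e, None} \<in> ?L" using True e Some single by (intro lX) (simp_all only: SN, simp)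
          then show ?thesis using True Some by (intro bexI [of _ None]) simp
        next
          case False
          have d: "x \<triangle> {i} \<triangle> y = x \<triangle> y - {i}"
            unfolding tog_right_commute [of x _ y] using i by (intro tog_subset) blast
          have "even (card (x \<triangle> y))" using cardxy False by simp
          then have "odd (card (x \<triangle> {i} \<triangle> y))"
            unfolding d using card_Suc_Diff1 [OF finxy i] by (metis even_Suc)
          then obtain t where t: "t \<in> x \<triangle> y - {i}" "x \<triangle> {i} \<triangle> {t} \<in> J"
            using single_step [OF nv single(1) y] unfolding d by blast
          have "x \<triangle> {i} \<triangle> {t} = x \<triangle> {i,t}"
            using t(1) by (simp add: tog_assoc tog_disjoint insert_commute)
          then show ?thesis using l1 [of t] t by simp
        qed
      next
        case (double t)
        then show ?thesis using l1 by blast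
      qed
    qed
    assume four: "card (X \<triangle> Y) = 4"
    define Goal where "Goal \<longleftrightarrow> (\<exists>t\<in>X \<triangle> Y. t \<noteq> e \<and> X \<triangle> {e,t} \<in> ?L \<and> Y \<triangle> {e,t} \<in> ?L \<and>
        F (Some -` (X \<triangle> {e,t})) + F (Some -` (Y \<triangle> {e,t})) \<le> F (Some -` X) + F (Some -` Y))"
    have GoalI: Goal if "t \<in> X \<triangle> Y" "t \<noteq> e" "x \<triangle> Some -` {e,t} \<in> J" "y \<triangle> Some -` {e,t} \<in> J"
       "F (x \<triangle> Some -` {e,t}) + F (y \<triangle> Some -` {e,t}) \<le> F x + F y" for t
      unfolding Goal_def
    proof (intro bexI conjI)
      show "X \<triangle> {e,t} \<in> ?L" "Y \<triangle> {e,t} \<in> ?L"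
        by (rule lX [OF e that(1) that(2) [symmetric] that(3)], rule lY [OF e that(1) that(2) [symmetric] that(4)])
      show "F (Some -` (X \<triangle> {e,t})) + F (Some -` (Y \<triangle> {e,t})) \<le> F (Some -` X) + F (Some -` Y)"
        using that(5) unfolding vimage_tog [of Some X] vimage_tog [of Some Y] x_def y_def .
    qed (use that in simp_all)
    have Goal
    proof (cases "None \<in> X \<triangle> Y")
      case True
      then have three: "card (x \<triangle> y) = 3" using cardxy(1) four by simp
      show Goal
      proof (cases e)
        case None
        obtain i where i: "i \<in> x \<triangle> y" "x \<triangle> {i} \<in> J" "y \<triangle> {i} \<in> J"
            "F (x \<triangle> {i}) + F (y \<triangle> {i}) \<le> F x + F y"
          using three_exchange [OF nv x y three] by blast
        show Goal using i None by (intro GoalI [of "Some i"]) (simp_all only: SN Smem, simp)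
      next
        case (Some i)
        then have i: "i \<in> x \<triangle> y" using e by (simp only: Smem)
        from nv x y i show Goal
        proof (cases rule: nat_valuatedE)
          case single
          then show Goal using True Some by (intro GoalI [of None]) (simp_all only: SN, simp)
        next
          case (double t)
          then show Goal using Some by (intro GoalI [of "Some t"]) (simp_all only: SN Smem, simp)
        qed
      qed
    next
      case False
      define V where "V = x \<triangle> y"
      have V4: "card V = 4" using cardxy(1) four False by (simp add: V_def)
      obtain s where s: "e = Some s" using e False by (cases e) auto
      have sV: "s \<in> V" using e unfolding s V_def by (simp only: Smem)
      show Goal
      proof (rule ccontr)
        assume "\<not> Goal"
        then have fail: "F x + F y < F (x \<triangle> {s,t}) + F (y \<triangle> {s,t})"
          if "t \<in> x \<triangle> y" "t \<noteq> s" "x \<triangle> {s,t} \<in> J" "y \<triangle> {s,t} \<in> J" for t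
          using GoalI [of "Some t"] that unfolding s SN Smem by force
        have near: "\<exists>i. i \<in> V \<and> i \<noteq> j \<and> u \<triangle> {i} \<in> J \<and> w \<triangle> {i,j} \<in> J \<and>
            F (u \<triangle> {i}) + F (w \<triangle> {i,j}) \<le> F u + F (w \<triangle> {j})"
          if u: "u \<in> J" and w: "w \<triangle> {j} \<in> J" and uw: "u \<triangle> w = V" and j: "j \<in> V" for u w j
        proof -
          have d: "u \<triangle> (w \<triangle> {j}) = V - {j}"
            unfolding tog_assoc [symmetric] uw using j by (intro tog_subset) simp
          have "card (u \<triangle> (w \<triangle> {j})) = 3" unfolding d using j V4 by (simp add: card_Diff_singleton)
          from three_exchange [OF nv u w this] obtain i where i: "i \<in> V - {j}" "u \<triangle> {i} \<in> J"
            "w \<triangle> {j} \<triangle> {i} \<in> J" "F (u \<triangle> {i}) + F (w \<triangle> {j} \<triangle> {i}) \<le> F u + F (w \<triangle> {j})"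
            unfolding d by blast
          have "w \<triangle> {j} \<triangle> {i} = w \<triangle> {i,j}"
            using i(1) by (simp add: tog_assoc tog_disjoint insert_commute)
          then show ?thesis using i by auto
        qed
        show False
        proof (rule no_descent [where V = V and H = "{i\<in>V. x \<triangle> {i} \<in> J}" and K = "{j\<in>V. y \<triangle> {j} \<in> J}"
              and P = "{Z. x \<triangle> Z \<in> J}" and G = "\<lambda>Z. F (x \<triangle> Z)" and h = "\<lambda>i. F (x \<triangle> {i})"
              and k = "\<lambda>j. F (y \<triangle> {j})" and ?A1.0 = "F x" and ?A2.0 = "F y"])
          show "card V = 4" by (fact V4)
          show "{i\<in>V. x \<triangle> {i} \<in> J} \<union> {j\<in>V. y \<triangle> {j} \<in> J} \<noteq> {}"
            using nv x y sV [unfolded V_def]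
          proof (cases rule: nat_valuatedE)
            case single
            then show ?thesis using sV by blast
          next
            case (double t)
            then show ?thesis using fail [of t] by linarith
          qed
          fix j
          show "\<exists>i\<in>{i\<in>V. x \<triangle> {i} \<in> J}. i \<noteq> j \<and> V - {i,j} \<in> {Z. x \<triangle> Z \<in> J} \<and>
             F (x \<triangle> {i}) + F (x \<triangle> (V - {i,j})) \<le> F x + F (y \<triangle> {j})" if "j \<in> {j\<in>V. y \<triangle> {j} \<in> J}"
          proof -
            note jK = that
            obtain i where i: "i \<in> V" "i \<noteq> j" "x \<triangle> {i} \<in> J" "y \<triangle> {i,j} \<in> J"
              "F (x \<triangle> {i}) + F (y \<triangle> {i,j}) \<le> F x + F (y \<triangle> {j})"
              using near [of x y j] x jK V_def by blast
            have "{i,j} \<subseteq> V" using i jK by simp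
            then have "y \<triangle> {i,j} = x \<triangle> (V - {i,j})" unfolding V_def by (rule tog_compl)
            then show ?thesis using i by auto
          qed
          show "\<exists>i\<in>{j\<in>V. y \<triangle> {j} \<in> J}. i \<noteq> j \<and> {i,j} \<in> {Z. x \<triangle> Z \<in> J} \<and>
             F (y \<triangle> {i}) + F (x \<triangle> {i,j}) \<le> F y + F (x \<triangle> {j})" if "j \<in> {i\<in>V. x \<triangle> {i} \<in> J}"
            using near [of y x j] y that V_def tog_commute [of x y] by blast
        next
          fix i j
          assume "i \<in> V" "j \<in> V" "i \<noteq> j" "{i,j} \<in> {Z. x \<triangle> Z \<in> J}" "V - {i,j} \<in> {Z. x \<triangle> Z \<in> J}"
          then show "F x + F y < F (x \<triangle> {i,j}) + F (x \<triangle> (V - {i,j}))"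
            using gap_from_failure [where J = J and F = F, OF V4 [unfolded V_def] sV [unfolded V_def] fail]
            unfolding V_def by blast
        qed auto
      qed
    qed
    then show "\<exists>t\<in>X \<triangle> Y. t \<noteq> e \<and> X \<triangle> {e,t} \<in> ?L \<and> Y \<triangle> {e,t} \<in> ?L \<and>
        F (Some -` (X \<triangle> {e,t})) + F (Some -` (Y \<triangle> {e,t})) \<le> F (Some -` X) + F (Some -` Y)"
      unfolding Goal_def .
  }
qed

section \<open>Merging two elements\<close>

text \<open>Merging \<open>a\<close> and \<open>b\<close>: the sets that contain both or neither of \<open>a\<close> and \<open>b\<close> are kept, both elements are
  forgotten, and the smaller value is taken.\<close>

definition merge_dom :: "'e \<Rightarrow> 'e \<Rightarrow> 'e set set \<Rightarrow> 'e set set" where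
  "merge_dom a b J = (\<lambda>Z. Z - {a,b}) ` {Z\<in>J. a \<in> Z \<longleftrightarrow> b \<in> Z}"

definition merge_val :: "'e \<Rightarrow> 'e \<Rightarrow> 'e set set \<Rightarrow> ('e set \<Rightarrow> real) \<Rightarrow> 'e set \<Rightarrow> real" where
  "merge_val a b J F X = Min (F ` {Z\<in>J. (a \<in> Z \<longleftrightarrow> b \<in> Z) \<and> Z - {a,b} = X})"

lemma merge_val_le:
  assumes "finite J" "Z \<in> J" "a \<in> Z \<longleftrightarrow> b \<in> Z"
  shows "Z - {a,b} \<in> merge_dom a b J" "merge_val a b J F (Z - {a,b}) \<le> F Z"
  using assms unfolding merge_dom_def merge_val_def by (auto intro!: Min_le)

lemma merge_val_attained:
  assumes "finite J" "X \<in> merge_dom a b J"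
  obtains Z where "Z \<in> J" "a \<in> Z \<longleftrightarrow> b \<in> Z" "Z - {a,b} = X" "merge_val a b J F X = F Z"
proof -
  let ?S = "{Z\<in>J. (a \<in> Z \<longleftrightarrow> b \<in> Z) \<and> Z - {a,b} = X}"
  have "finite ?S" "?S \<noteq> {}" using assms unfolding merge_dom_def by auto
  then have "Min (F ` ?S) \<in> F ` ?S" by (intro Min_in) auto
  then show thesis using that unfolding merge_val_def by blast
qed

lemma tog_tog_disjoint: "A \<inter> B = {} \<Longrightarrow> X \<triangle> A \<triangle> B = X \<triangle> (A \<union> B)"
  by (simp add: tog_assoc tog_disjoint)

text \<open>Let \<open>P\<close> and \<open>Q\<close> attain the merged values at \<open>X\<close> and \<open>Y\<close>.  Only the case that exactly one of them contains
  \<open>a\<close> and \<open>b\<close> needs work, as an exchange between \<open>P\<close> and \<open>Q\<close> may then involve just one of \<open>a\<close>, \<open>b\<close>.  At distance four the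
  values \<open>h i = F (P \<triangle> {i,b})\<close> and \<open>k j = F (Q \<triangle> {j,a})\<close> descend: exchanging \<open>b\<close> between \<open>P\<close> and \<open>Q \<triangle> {j,a}\<close>, or \<open>a\<close> between
  \<open>Q\<close> and \<open>P \<triangle> {j,b}\<close>, completes one of the two sets to a balanced one.\<close>

lemma even_valuated_merge:
  assumes ev: "even_valuated E J F" and ab: "a \<noteq> b"
  shows "even_valuated (E - {a,b}) (merge_dom a b J) (merge_val a b J F)"
proof (rule local_to_global)
  have finE: "finite E" and JE: "J \<subseteq> Pow E" and evJ: "\<And>X. X \<in> J \<Longrightarrow> even (card X)"
    using ev by (auto simp: even_valuated_def)
  have finJ: "finite J" using finE JE finite_subset by blast
  let ?J = "merge_dom a b J" and ?G = "merge_val a b J F"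
  show "finite (E - {a,b})" using finE by simp
  show "?J \<subseteq> Pow (E - {a,b})" using JE unfolding merge_dom_def by blast
  show "even (card X)" if "X \<in> ?J" for X
  proof -
    obtain Z where Z: "Z \<in> J" "a \<in> Z \<longleftrightarrow> b \<in> Z" "Z - {a,b} = X"
      using merge_val_attained [OF finJ \<open>X \<in> ?J\<close>] by metis
    have finZ: "finite Z" using Z(1) JE finE finite_subset by blast
    show ?thesis
    proof (cases "a \<in> Z")
      case True
      then have "X = Z \<triangle> {a,b}" using Z(2,3) by (subst tog_subset) auto
      then show ?thesis using ab evJ [OF Z(1)] finZ by (simp add: even_card_tog)
    next
      case False
      then have "X = Z" using Z(2,3) by blast
      then show ?thesis using evJ [OF Z(1)] by simp
    qed
  qed
  have move: "(P - {a,b}) \<triangle> T' \<in> ?J" "?G ((P - {a,b}) \<triangle> T') \<le> F (P \<triangle> T)"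
    if "a \<in> P \<longleftrightarrow> b \<in> P" "a \<in> T \<longleftrightarrow> b \<in> T" "P \<triangle> T \<in> J" "T - {a,b} = T'" for P T T'
  proof -
    have "(P - {a,b}) \<triangle> T' = P \<triangle> T - {a,b}" unfolding that(4) [symmetric] tog_def by blast
    moreover have "a \<in> P \<triangle> T \<longleftrightarrow> b \<in> P \<triangle> T" using that(1,2) by simp
    ultimately show "(P - {a,b}) \<triangle> T' \<in> ?J" "?G ((P - {a,b}) \<triangle> T') \<le> F (P \<triangle> T)"
      using merge_val_le [OF finJ that(3)] by simp_all
  qed
  { fix X Y s assume X: "X \<in> ?J" and Y: "Y \<in> ?J" and s: "s \<in> X \<triangle> Y"
    obtain P where P: "P \<in> J" "a \<in> P \<longleftrightarrow> b \<in> P" "P - {a,b} = X" "?G X = F P"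
      using merge_val_attained [OF finJ X] by metis
    obtain Q where Q: "Q \<in> J" "a \<in> Q \<longleftrightarrow> b \<in> Q" "Q - {a,b} = Y" "?G Y = F Q"
      using merge_val_attained [OF finJ Y] by metis
    define V where "V = X \<triangle> Y"
    have V: "V = P \<triangle> Q - {a,b}" unfolding V_def P(3) [symmetric] Q(3) [symmetric] tog_def by blast
    have sV: "s \<in> V" using s by (simp only: V_def)
    have sPQ: "s \<in> P \<triangle> Q" and sab: "s \<noteq> a" "s \<noteq> b" using sV unfolding V by blast+
    have moveP: "X \<triangle> T' \<in> ?J" "?G (X \<triangle> T') \<le> F (P \<triangle> T)"
      if "P \<triangle> T \<in> J" "a \<in> T \<longleftrightarrow> b \<in> T" "T - {a,b} = T'" for T T'
      using move [OF P(2) that(2,1,3)] unfolding P(3) by blast+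
    have moveQ: "Y \<triangle> T' \<in> ?J" "?G (Y \<triangle> T') \<le> F (Q \<triangle> T)"
      if "Q \<triangle> T \<in> J" "a \<in> T \<longleftrightarrow> b \<in> T" "T - {a,b} = T'" for T T'
      using move [OF Q(2) that(2,1,3)] unfolding Q(3) by blast+
    have ab_PQ: "{a,b} \<subseteq> P \<triangle> Q" if "a \<in> P \<triangle> Q \<or> b \<in> P \<triangle> Q"
      using that P(2) Q(2) by auto
    obtain t where t: "t \<in> P \<triangle> Q" "t \<noteq> s" "P \<triangle> {s,t} \<in> J" "Q \<triangle> {s,t} \<in> J"
        "F (P \<triangle> {s,t}) + F (Q \<triangle> {s,t}) \<le> F P + F Q"
      using even_valuatedE [OF ev P(1) Q(1) sPQ] by blast
    have good: "t \<in> V \<and> X \<triangle> {s,t} \<in> ?J \<and> Y \<triangle> {s,t} \<in> ?J \<and>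
        ?G (X \<triangle> {s,t}) + ?G (Y \<triangle> {s,t}) \<le> ?G X + ?G Y" if "t \<notin> {a,b}"
    proof -
      have T: "a \<in> {s,t} \<longleftrightarrow> b \<in> {s,t}" "{s,t} - {a,b} = {s,t}" using sab that by auto
      show ?thesis
        using moveP [OF t(3) T] moveQ [OF t(4) T] t(1,5) that unfolding V P(4) Q(4) by simp
    qed
    show "\<exists>t\<in>X \<triangle> Y. t \<noteq> s \<and> X \<triangle> {s,t} \<in> ?J"
    proof (cases "t \<in> {a,b}")
      case False
      then show ?thesis using good t(2) unfolding V_def by blast
    next
      case True
      then obtain c where c: "{t,c} = {a,b}" "c \<noteq> t" using ab by blast
      have cPQ: "c \<in> P \<triangle> Q" using ab_PQ True t(1) c by blast
      have cs: "c \<noteq> s" using c sab by blast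
      define P1 where "P1 = P \<triangle> {s,t}"
      have P1: "P1 \<in> J" using t by (simp add: P1_def)
      have P1Q: "P1 \<triangle> Q = P \<triangle> Q - {s,t}"
        unfolding P1_def tog_right_commute [of P _ Q] using t(1) sPQ by (intro tog_subset) blast
      have "c \<in> P1 \<triangle> Q" using cPQ cs c(2) unfolding P1Q by blast
      then obtain r where r: "r \<in> P1 \<triangle> Q" "r \<noteq> c" "P1 \<triangle> {c,r} \<in> J"
        using even_valuatedE [OF ev P1 Q(1)] by metis
      have rV: "r \<in> V" "r \<noteq> s" "r \<noteq> t" using r(1,2) c(1) unfolding P1Q V by blast+
      define T where "T = {s,t} \<union> {c,r}"
      have "P1 \<triangle> {c,r} = P \<triangle> T"
        unfolding P1_def T_def using rV cs c(2) by (intro tog_tog_disjoint) auto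
      then have "P \<triangle> T \<in> J" using r by simp
      moreover have "a \<in> T \<longleftrightarrow> b \<in> T" using c(1) unfolding T_def by blast
      moreover have "T - {a,b} = {s,r}"
        using rV(2,3) r(2) t(2) cs unfolding T_def c(1) [symmetric] by blast
      ultimately have "X \<triangle> {s,r} \<in> ?J" by (rule moveP)
      then show ?thesis using rV unfolding V_def by blast
    qed
    assume "card (X \<triangle> Y) = 4"
    then have V4: "card V = 4" by (simp only: V_def)
    show "\<exists>t\<in>X \<triangle> Y. t \<noteq> s \<and> X \<triangle> {s,t} \<in> ?J \<and> Y \<triangle> {s,t} \<in> ?J \<and>
        ?G (X \<triangle> {s,t}) + ?G (Y \<triangle> {s,t}) \<le> ?G X + ?G Y"
    proof (rule ccontr)
      assume neg: "\<not> ?thesis"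
      then have fail: "?G X + ?G Y < ?G (X \<triangle> {s,t}) + ?G (Y \<triangle> {s,t})"
        if "t \<in> X \<triangle> Y" "t \<noteq> s" "X \<triangle> {s,t} \<in> ?J" "Y \<triangle> {s,t} \<in> ?J" for t
        using that by (meson not_le)
      have tab: "t \<in> {a,b}" using good t(2) neg unfolding V_def by blast
      have PQ: "P \<triangle> Q = V \<union> {a,b}" using ab_PQ tab t(1) unfolding V by blast
      have abV: "a \<notin> V" "b \<notin> V" unfolding V by blast+
      have near: "\<exists>i. i \<in> V \<and> i \<noteq> j \<and> A \<triangle> {i,d} \<in> J \<and> B \<triangle> {i,j,a,b} \<in> J \<and>
            F (A \<triangle> {i,d}) + F (B \<triangle> {i,j,a,b}) \<le> F A + F (B \<triangle> {j,c})"
        if A: "A \<in> J" and B: "B \<triangle> {j,c} \<in> J" and AB: "A \<triangle> B = V \<union> {a,b}" and j: "j \<in> V"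
          and cd: "{c,d} = {a,b}" "c \<noteq> d" for A B j c d
      proof -
        have "V \<inter> {c,d} = {}" unfolding cd using abV by simp
        then have cdV: "c \<notin> V" "d \<notin> V" by blast+
        have e: "A \<triangle> (B \<triangle> {j,c}) = V - {j} \<union> {d}"
        proof -
          have "A \<triangle> (B \<triangle> {j,c}) = V \<union> {c,d} - {j,c}"
            unfolding tog_assoc [symmetric] AB cd using j cd(1) by (intro tog_subset) blast
          also have "\<dots> = V - {j} \<union> {d}" using cdV cd(2) j by blast
          finally show ?thesis .
        qed
        have "d \<in> A \<triangle> (B \<triangle> {j,c})" unfolding e by blast
        from even_valuatedE [OF ev A B this] obtain i where i: "i \<in> V - {j} \<union> {d}" "i \<noteq> d"
          "A \<triangle> {d,i} \<in> J" "B \<triangle> {j,c} \<triangle> {d,i} \<in> J"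
          "F (A \<triangle> {d,i}) + F (B \<triangle> {j,c} \<triangle> {d,i}) \<le> F A + F (B \<triangle> {j,c})"
          unfolding e by blast
        have iV: "i \<in> V" "i \<noteq> j" using i(1,2) by blast+
        have "B \<triangle> {j,c} \<triangle> {d,i} = B \<triangle> ({j,c} \<union> {d,i})"
          using iV cdV cd(2) j by (intro tog_tog_disjoint) auto
        also have "{j,c} \<union> {d,i} = {i,j} \<union> {c,d}" by blast
        also have "\<dots> = {i,j,a,b}" unfolding cd by blast
        finally show ?thesis using i iV unfolding insert_commute [of d i] by metis
      qed
      have abT: "a \<in> {i,j,a,b} \<longleftrightarrow> b \<in> {i,j,a,b}" for i j by simp
      have Tij: "{i,j,a,b} - {a,b} = {i,j}" if "i \<in> V" "j \<in> V" for i j using that abV by blast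
      show False
      proof (rule no_descent [where V = V and H = "{i\<in>V. P \<triangle> {i,b} \<in> J}" and K = "{j\<in>V. Q \<triangle> {j,a} \<in> J}"
            and P = "{Z. X \<triangle> Z \<in> ?J}" and G = "\<lambda>Z. ?G (X \<triangle> Z)" and h = "\<lambda>i. F (P \<triangle> {i,b})"
            and k = "\<lambda>j. F (Q \<triangle> {j,a})" and ?A1.0 = "F P" and ?A2.0 = "F Q"])
        show "card V = 4" by (fact V4)
        show "{i\<in>V. P \<triangle> {i,b} \<in> J} \<union> {j\<in>V. Q \<triangle> {j,a} \<in> J} \<noteq> {}"
          using tab t(3,4) sV by blast
        fix j
        show "\<exists>i\<in>{i\<in>V. P \<triangle> {i,b} \<in> J}. i \<noteq> j \<and> V - {i,j} \<in> {Z. X \<triangle> Z \<in> ?J} \<and>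
           F (P \<triangle> {i,b}) + ?G (X \<triangle> (V - {i,j})) \<le> F P + F (Q \<triangle> {j,a})"
          if jK: "j \<in> {j\<in>V. Q \<triangle> {j,a} \<in> J}"
        proof -
          obtain i where i: "i \<in> V" "i \<noteq> j" "P \<triangle> {i,b} \<in> J" "Q \<triangle> {i,j,a,b} \<in> J"
            "F (P \<triangle> {i,b}) + F (Q \<triangle> {i,j,a,b}) \<le> F P + F (Q \<triangle> {j,a})"
            using near [OF P(1) _ PQ, of j a b] jK ab by blast
          have jV: "j \<in> V" using jK by blast
          have "{i,j} \<subseteq> V" using i(1) jV by simp
          then have eq: "Y \<triangle> {i,j} = X \<triangle> (V - {i,j})" unfolding V_def by (rule tog_compl)
          note mv = moveQ [OF i(4) abT Tij [OF i(1) jV], unfolded eq]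
          show ?thesis using i mv by (intro bexI [of _ i]) auto
        qed
        show "\<exists>i\<in>{j\<in>V. Q \<triangle> {j,a} \<in> J}. i \<noteq> j \<and> {i,j} \<in> {Z. X \<triangle> Z \<in> ?J} \<and>
           F (Q \<triangle> {i,a}) + ?G (X \<triangle> {i,j}) \<le> F Q + F (P \<triangle> {j,b})"
          if jH: "j \<in> {i\<in>V. P \<triangle> {i,b} \<in> J}"
        proof -
          obtain i where i: "i \<in> V" "i \<noteq> j" "Q \<triangle> {i,a} \<in> J" "P \<triangle> {i,j,a,b} \<in> J"
            "F (Q \<triangle> {i,a}) + F (P \<triangle> {i,j,a,b}) \<le> F Q + F (P \<triangle> {j,b})"
            using near [OF Q(1) _ PQ [unfolded tog_commute [of P]], of j b a] jH ab by blast
          have jV: "j \<in> V" using jH by blast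
          note mv = moveP [OF i(4) abT Tij [OF i(1) jV]]
          show ?thesis using i mv by (intro bexI [of _ i]) auto
        qed
      next
        fix i j
        assume "i \<in> V" "j \<in> V" "i \<noteq> j" "{i,j} \<in> {Z. X \<triangle> Z \<in> ?J}" "V - {i,j} \<in> {Z. X \<triangle> Z \<in> ?J}"
        then show "F P + F Q < ?G (X \<triangle> {i,j}) + ?G (X \<triangle> (V - {i,j}))"
          using gap_from_failure [where J = ?J and F = ?G, OF V4 [unfolded V_def] sV [unfolded V_def] fail]
          unfolding V_def P(4) Q(4) by blast
      qed auto
    qed
  }
qed

text \<open>The exchange obtained after merging all pairs \<open>\<alpha> i\<close>, \<open>\<beta> i\<close>, expressed by balanced sets of the
  original system.\<close>

lemma even_valuated_merge_pairs:
  fixes \<alpha> \<beta> :: "'i \<Rightarrow> 'e"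
  assumes "finite I" and inj: "inj \<alpha>" "inj \<beta>" and disj: "\<And>i j. \<alpha> i \<noteq> \<beta> j"
    and "even_valuated E J F" and "X \<in> J" "Y \<in> J"
    and "\<And>i. i \<in> I \<Longrightarrow> \<alpha> i \<in> X \<longleftrightarrow> \<beta> i \<in> X" "\<And>i. i \<in> I \<Longrightarrow> \<alpha> i \<in> Y \<longleftrightarrow> \<beta> i \<in> Y"
    and "s \<in> X \<triangle> Y - (\<alpha> ` I \<union> \<beta> ` I)"
  shows "\<exists>t\<in>X \<triangle> Y - (\<alpha> ` I \<union> \<beta> ` I). t \<noteq> s \<and> (\<exists>X'\<in>J. \<exists>Y'\<in>J.
      (\<forall>i\<in>I. \<alpha> i \<in> X' \<longleftrightarrow> \<beta> i \<in> X') \<and> (\<forall>i\<in>I. \<alpha> i \<in> Y' \<longleftrightarrow> \<beta> i \<in> Y') \<and>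
      X' - (\<alpha> ` I \<union> \<beta> ` I) = X \<triangle> {s,t} - (\<alpha> ` I \<union> \<beta> ` I) \<and>
      Y' - (\<alpha> ` I \<union> \<beta> ` I) = Y \<triangle> {s,t} - (\<alpha> ` I \<union> \<beta> ` I) \<and> F X' + F Y' \<le> F X + F Y)"
  using assms(1,5-)
proof (induction I arbitrary: E J F X Y rule: finite_induct)
  case empty
  then have "s \<in> X \<triangle> Y" by (simp only: image_empty Un_empty_left Diff_empty)
  from even_valuatedE [OF empty(1-3) this] obtain t where "t \<in> X \<triangle> Y" "t \<noteq> s"
      "X \<triangle> {s,t} \<in> J" "Y \<triangle> {s,t} \<in> J" "F (X \<triangle> {s,t}) + F (Y \<triangle> {s,t}) \<le> F X + F Y" .
  then show ?case
    unfolding image_empty Un_empty_left Diff_empty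
    by (metis empty_iff)
next
  case (insert k I)
  let ?a = "\<alpha> k" and ?b = "\<beta> k"
  let ?D = "\<alpha> ` I \<union> \<beta> ` I" and ?J = "merge_dom ?a ?b J" and ?G = "merge_val ?a ?b J F"
  have D': "\<alpha> ` insert k I \<union> \<beta> ` insert k I = {?a,?b} \<union> ?D" by blast
  have finJ: "finite J" using insert.prems(1) finite_subset unfolding even_valuated_def by blast
  have ne: "\<alpha> i \<notin> {?a,?b}" "\<beta> i \<notin> {?a,?b}" if "i \<in> I" for i
  proof -
    have "i \<noteq> k" using that insert.hyps by blast
    then show "\<alpha> i \<notin> {?a,?b}" "\<beta> i \<notin> {?a,?b}"
      using inj disj [of i k] disj [of k i] by (auto simp: inj_def)
  qed
  have tog_D: "(X - {?a,?b}) \<triangle> (Y - {?a,?b}) - ?D = X \<triangle> Y - ({?a,?b} \<union> ?D)"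
    unfolding tog_def by blast
  have balX: "?a \<in> X \<longleftrightarrow> ?b \<in> X" and balY: "?a \<in> Y \<longleftrightarrow> ?b \<in> Y"
    using insert.prems(4,5) by blast+
  have "\<exists>t\<in>(X - {?a,?b}) \<triangle> (Y - {?a,?b}) - ?D. t \<noteq> s \<and> (\<exists>X'\<in>?J. \<exists>Y'\<in>?J.
      (\<forall>i\<in>I. \<alpha> i \<in> X' \<longleftrightarrow> \<beta> i \<in> X') \<and> (\<forall>i\<in>I. \<alpha> i \<in> Y' \<longleftrightarrow> \<beta> i \<in> Y') \<and>
      X' - ?D = (X - {?a,?b}) \<triangle> {s,t} - ?D \<and> Y' - ?D = (Y - {?a,?b}) \<triangle> {s,t} - ?D \<and>
      ?G X' + ?G Y' \<le> ?G (X - {?a,?b}) + ?G (Y - {?a,?b}))"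
  proof (rule insert.IH)
    show "even_valuated (E - {?a,?b}) ?J ?G"
      using even_valuated_merge [OF insert.prems(1) disj] .
    show "X - {?a,?b} \<in> ?J" by (rule merge_val_le [OF finJ insert.prems(2) balX])
    show "Y - {?a,?b} \<in> ?J" by (rule merge_val_le [OF finJ insert.prems(3) balY])
    show "s \<in> (X - {?a,?b}) \<triangle> (Y - {?a,?b}) - ?D"
      using insert.prems(6) unfolding tog_D D' .
    fix i assume i: "i \<in> I"
    show "\<alpha> i \<in> X - {?a,?b} \<longleftrightarrow> \<beta> i \<in> X - {?a,?b}" "\<alpha> i \<in> Y - {?a,?b} \<longleftrightarrow> \<beta> i \<in> Y - {?a,?b}"
      using ne [OF i] insert.prems(4,5) [of i] i by simp_all
  qed
  then obtain t X' Y' where t: "t \<in> X \<triangle> Y - ({?a,?b} \<union> ?D)" "t \<noteq> s" and X': "X' \<in> ?J" and Y': "Y' \<in> ?J"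
    and bal: "\<forall>i\<in>I. \<alpha> i \<in> X' \<longleftrightarrow> \<beta> i \<in> X'" "\<forall>i\<in>I. \<alpha> i \<in> Y' \<longleftrightarrow> \<beta> i \<in> Y'"
    and eq: "X' - ?D = (X - {?a,?b}) \<triangle> {s,t} - ?D" "Y' - ?D = (Y - {?a,?b}) \<triangle> {s,t} - ?D"
    and le: "?G X' + ?G Y' \<le> ?G (X - {?a,?b}) + ?G (Y - {?a,?b})"
    unfolding tog_D by (elim bexE conjE)
  obtain P where P: "P \<in> J" "?a \<in> P \<longleftrightarrow> ?b \<in> P" "P - {?a,?b} = X'" "?G X' = F P"
    using merge_val_attained [OF finJ X'] by metis
  obtain Q where Q: "Q \<in> J" "?a \<in> Q \<longleftrightarrow> ?b \<in> Q" "Q - {?a,?b} = Y'" "?G Y' = F Q"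
    using merge_val_attained [OF finJ Y'] by metis
  have st: "{?a,?b} \<inter> {s,t} = {}" using t insert.prems(6) unfolding D' by blast
  have eqP: "P - ({?a,?b} \<union> ?D) = X \<triangle> {s,t} - ({?a,?b} \<union> ?D)"
  proof -
    have "P - ({?a,?b} \<union> ?D) = X' - ?D" using P(3) by blast
    also have "\<dots> = X \<triangle> {s,t} - ({?a,?b} \<union> ?D)" unfolding eq using st unfolding tog_def by blast
    finally show ?thesis .
  qed
  have eqQ: "Q - ({?a,?b} \<union> ?D) = Y \<triangle> {s,t} - ({?a,?b} \<union> ?D)"
  proof -
    have "Q - ({?a,?b} \<union> ?D) = Y' - ?D" using Q(3) by blast
    also have "\<dots> = Y \<triangle> {s,t} - ({?a,?b} \<union> ?D)" unfolding eq using st unfolding tog_def by blast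
    finally show ?thesis .
  qed
  have balP: "\<alpha> i \<in> P \<longleftrightarrow> \<beta> i \<in> P" "\<alpha> i \<in> Q \<longleftrightarrow> \<beta> i \<in> Q" if "i \<in> insert k I" for i
    using that P(2) Q(2) bal ne [of i] unfolding P(3) [symmetric] Q(3) [symmetric] by auto
  have le': "F P + F Q \<le> F X + F Y"
    using le merge_val_le(2) [OF finJ insert.prems(2) balX, of F]
      merge_val_le(2) [OF finJ insert.prems(3) balY, of F] unfolding P(4) Q(4) by linarith
  show ?case
    unfolding D'
  proof (rule bexI [OF _ t(1)], rule conjI [OF t(2)], rule bexI [OF _ P(1)], rule bexI [OF _ Q(1)])
    show "(\<forall>i\<in>insert k I. (\<alpha> i \<in> P) = (\<beta> i \<in> P)) \<and> (\<forall>i\<in>insert k I. (\<alpha> i \<in> Q) = (\<beta> i \<in> Q)) \<and>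
        P - ({?a,?b} \<union> ?D) = X \<triangle> {s,t} - ({?a,?b} \<union> ?D) \<and>
        Q - ({?a,?b} \<union> ?D) = Y \<triangle> {s,t} - ({?a,?b} \<union> ?D) \<and> F P + F Q \<le> F X + F Y"
      using balP eqP eqQ le' by (intro conjI ballI)
  qed
qed

section \<open>Splitting coordinates and direct sums\<close>

lemma increment_iff:
  "increment N x y s \<longleftrightarrow>
    (\<exists>i\<in>N. s = unit_vec i \<and> x i < y i \<or> s = - unit_vec i \<and> y i < x i)"
proof -
  have pos: "x + unit_vec i \<in> {inf x y..sup x y} \<longleftrightarrow> x i < y i" for i
  proof
    assume "x + unit_vec i \<in> {inf x y..sup x y}"
    then have "(x + unit_vec i) i \<le> sup x y i" by (simp add: le_fun_def)
    then show "x i < y i" by (simp add: unit_vec_def sup_max max_def split: if_splits)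
  next
    assume "x i < y i"
    then show "x + unit_vec i \<in> {inf x y..sup x y}"
      by (auto simp: le_fun_def unit_vec_def sup_max max_def inf_min min_def)
  qed
  have neg: "x + - unit_vec i \<in> {inf x y..sup x y} \<longleftrightarrow> y i < x i" for i
  proof
    assume "x + - unit_vec i \<in> {inf x y..sup x y}"
    then have "inf x y i \<le> (x + - unit_vec i) i" by (simp only: le_fun_def atLeastAtMost_iff)
    then show "y i < x i" by (simp add: unit_vec_def inf_min min_def split: if_splits)
  next
    assume "y i < x i"
    then show "x + - unit_vec i \<in> {inf x y..sup x y}"
      by (auto simp: le_fun_def unit_vec_def sup_max max_def inf_min min_def)
  qed
  show ?thesis unfolding increment_def using pos neg by metis
qed

text \<open>The set \<open>X\<close> of pairs \<open>(i,k)\<close>, the \<open>k\<close>-th copies of the coordinates \<open>i\<close>, represents the integer vector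
  that exceeds \<open>l\<close> at \<open>i\<close> by the number of copies of \<open>i\<close> in \<open>X\<close>.\<close>

definition count_vec :: "('a \<Rightarrow> int) \<Rightarrow> ('a \<times> nat) set \<Rightarrow> 'a \<Rightarrow> int" where
  "count_vec l X = (\<lambda>i. l i + int (card {k. (i,k) \<in> X}))"

lemma card_tog_singleton:
  assumes "finite K"
  shows "int (card (K \<triangle> {k})) = int (card K) + (if k \<in> K then - 1 else 1)"
proof (cases "k \<in> K")
  case True
  then have "card (K - {k}) = card K - 1" "0 < card K" using assms card_gt_0_iff by auto
  then show ?thesis using True by (simp add: tog_subset)
next
  case False
  then show ?thesis using assms by (simp add: tog_disjoint)
qed

lemma finite_fibre: "finite X \<Longrightarrow> finite {k. (i,k) \<in> X}"
  by (rule finite_subset [of _ "snd ` X"]) (auto intro: rev_image_eqI)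

lemma count_vec_tog:
  assumes "finite X"
  shows "count_vec l (X \<triangle> {(i,k)}) = count_vec l X + (if (i,k) \<in> X then - unit_vec i else unit_vec i)"
proof
  fix j
  have "{k'. (j,k') \<in> X \<triangle> {(i,k)}} = (if j = i then {k'. (i,k') \<in> X} \<triangle> {k} else {k'. (j,k') \<in> X})"
    by (auto simp: tog_def)
  then show "count_vec l (X \<triangle> {(i,k)}) j = (count_vec l X + (if (i,k) \<in> X then - unit_vec i else unit_vec i)) j"
    using card_tog_singleton [OF finite_fibre [OF assms], of i k]
    by (simp add: count_vec_def unit_vec_def)
qed

lemma card_less_obtain:
  assumes "finite A" "card A < card B"
  obtains k where "k \<in> B" "k \<notin> A"
  using assms by (meson card_mono leD subsetI)

lemma card_le_obtain:
  assumes "finite A" "finite B" "card B \<le> card A" "k \<in> B" "k \<notin> A"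
  obtains m where "m \<in> A" "m \<notin> B"
  using assms by (metis card_seteq subsetI)

lemma tog_pair: "s \<noteq> t \<Longrightarrow> X \<triangle> {s,t} = X \<triangle> {s} \<triangle> {t}"
  using tog_tog_disjoint [of "{s}" "{t}" X] by (simp add: insert_commute)

lemma eff_dom_real_le:
  assumes nm: "\<And>x. x \<in> int_vecs S \<Longrightarrow> f x \<noteq> -\<infinity>"
    and "a \<in> eff_dom S f" "b \<in> eff_dom S f" "c \<in> eff_dom S f" "d \<in> eff_dom S f"
    and le: "f a + f b \<le> f c + f d"
  shows "real_of_ereal (f a) + real_of_ereal (f b) \<le> real_of_ereal (f c) + real_of_ereal (f d)"
proof -
  have "\<exists>r. f v = ereal r" if "v \<in> eff_dom S f" for v
    using nm [of v] that unfolding eff_dom_def by (cases "f v") auto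
  then obtain ra rb rc rd where "f a = ereal ra" "f b = ereal rb" "f c = ereal rc" "f d = ereal rd"
    using assms(2-5) by metis
  then show ?thesis using le by simp
qed

text \<open>If toggling \<open>s = (i,k)\<close> does not move \<open>x\<close> towards \<open>y\<close>, then some other copy of \<open>i\<close> can be toggled in the
  opposite direction, which leaves both vectors unchanged.\<close>

lemma nat_valuated_split:
  assumes f: "jump_M_nat_convex S f" and E: "finite E" "E \<subseteq> S \<times> UNIV"
  shows "nat_valuated E {X. X \<subseteq> E \<and> count_vec l X \<in> eff_dom S f} (\<lambda>X. real_of_ereal (f (count_vec l X)))"
  unfolding nat_valuated_def
proof (intro conjI ballI)
  let ?J = "{X. X \<subseteq> E \<and> count_vec l X \<in> eff_dom S f}" and ?F = "\<lambda>X. real_of_ereal (f (count_vec l X))"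
  show "finite E" by (fact E)
  show "?J \<subseteq> Pow E" by blast
  fix X Y s assume X: "X \<in> ?J" and Y: "Y \<in> ?J" and s: "s \<in> X \<triangle> Y"
  have nm: "\<And>x. x \<in> int_vecs S \<Longrightarrow> f x \<noteq> -\<infinity>" and exc: "JM_nat_EXC S f"
    using f by (auto simp: jump_M_nat_convex_def)
  define x y where "x = count_vec l X" and "y = count_vec l Y"
  have XE: "X \<subseteq> E" and YE: "Y \<subseteq> E" and x: "x \<in> eff_dom S f" and y: "y \<in> eff_dom S f"
    using X Y by (simp_all add: x_def y_def)
  have fin: "finite X" "finite Y" using XE YE E(1) finite_subset by blast+
  have tog_E: "Z \<triangle> {e} \<subseteq> E" if "Z \<subseteq> E" "e \<in> X \<triangle> Y" for Z e
    using that XE YE by (auto simp: tog_def)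
  obtain i k where ik: "s = (i,k)" by (cases s)
  have iS: "i \<in> S" using s XE YE E(2) unfolding ik tog_def by blast
  define \<sigma> where "\<sigma> = (if s \<in> X then - unit_vec i else unit_vec i)"
  have cX: "count_vec l (X \<triangle> {s}) = x + \<sigma>"
    unfolding \<sigma>_def ik x_def using count_vec_tog [OF fin(1)] .
  have cY: "count_vec l (Y \<triangle> {s}) = y - \<sigma>"
    using count_vec_tog [OF fin(2), of l i k] s unfolding \<sigma>_def ik y_def by auto
  have finX1: "finite (X \<triangle> {s})" and finY1: "finite (Y \<triangle> {s})"
    using fin by (simp_all add: finite_tog)
  have step: "count_vec l (X \<triangle> {s,t}) = x + \<sigma> + \<tau>" "count_vec l (Y \<triangle> {s,t}) = y - \<sigma> - \<tau>"
    if t: "t = (j,m)" "t \<noteq> s" "t \<in> X \<triangle> Y" and \<tau>: "\<tau> = (if t \<in> X then - unit_vec j else unit_vec j)" for t j m \<tau>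
  proof -
    have "t \<in> X \<triangle> {s} \<longleftrightarrow> t \<in> X" "t \<in> Y \<triangle> {s} \<longleftrightarrow> t \<notin> X" using t(2,3) by simp_all
    then show "count_vec l (X \<triangle> {s,t}) = x + \<sigma> + \<tau>" "count_vec l (Y \<triangle> {s,t}) = y - \<sigma> - \<tau>"
      using count_vec_tog [OF finX1, of l j m] count_vec_tog [OF finY1, of l j m] \<tau>
      unfolding tog_pair [OF t(2) [symmetric]] unfolding cX cY t(1) by simp_all
  qed
  have sub2: "X \<triangle> {s,t} \<subseteq> E" "Y \<triangle> {s,t} \<subseteq> E" if "t \<in> X \<triangle> Y" for t
    using that s XE YE by (auto simp: tog_def)
  show "(X \<triangle> {s} \<in> ?J \<and> Y \<triangle> {s} \<in> ?J \<and> ?F (X \<triangle> {s}) + ?F (Y \<triangle> {s}) \<le> ?F X + ?F Y) \<or>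
    (\<exists>t\<in>X \<triangle> Y. t \<noteq> s \<and> X \<triangle> {s,t} \<in> ?J \<and> Y \<triangle> {s,t} \<in> ?J \<and>
       ?F (X \<triangle> {s,t}) + ?F (Y \<triangle> {s,t}) \<le> ?F X + ?F Y)" (is "?single \<or> ?double")
  proof (cases "increment S x y \<sigma>")
    case True
    then consider (i) "x + \<sigma> \<in> eff_dom S f" "y - \<sigma> \<in> eff_dom S f" "f (x + \<sigma>) + f (y - \<sigma>) \<le> f x + f y"
      | (ii) \<tau> where "increment S (x + \<sigma>) y \<tau>" "x + \<sigma> + \<tau> \<in> eff_dom S f" "y - \<sigma> - \<tau> \<in> eff_dom S f"
          "f (x + \<sigma> + \<tau>) + f (y - \<sigma> - \<tau>) \<le> f x + f y"
      using exc x y unfolding JM_nat_EXC_def by metis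
    then show ?thesis
    proof cases
      case i
      then have ?single
        using eff_dom_real_le [OF nm i(1,2) x y i(3)] tog_E [OF XE s] tog_E [OF YE s]
        unfolding cX cY mem_Collect_eq x_def [symmetric] y_def [symmetric] by blast
      then show ?thesis ..
    next
      case ii
      obtain j where j: "\<tau> = unit_vec j \<and> (x + \<sigma>) j < y j \<or> \<tau> = - unit_vec j \<and> y j < (x + \<sigma>) j"
        using ii(1) unfolding increment_iff by blast
      have "\<exists>m. (j,m) \<noteq> s \<and> (j,m) \<in> X \<triangle> Y \<and> \<tau> = (if (j,m) \<in> X then - unit_vec j else unit_vec j)"
        using j
      proof
        assume *: "\<tau> = unit_vec j \<and> (x + \<sigma>) j < y j"
        then have "card {m. (j,m) \<in> X \<triangle> {s}} < card {m. (j,m) \<in> Y}"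
          unfolding cX [symmetric] y_def count_vec_def by linarith
        then obtain m where m: "(j,m) \<in> Y" "(j,m) \<notin> X \<triangle> {s}"
          using card_less_obtain [OF finite_fibre [OF finX1]] by blast
        then show ?thesis using * s by (intro exI [of _ m]) auto
      next
        assume *: "\<tau> = - unit_vec j \<and> y j < (x + \<sigma>) j"
        then have "card {m. (j,m) \<in> Y} < card {m. (j,m) \<in> X \<triangle> {s}}"
          unfolding cX [symmetric] y_def count_vec_def by linarith
        then obtain m where m: "(j,m) \<notin> Y" "(j,m) \<in> X \<triangle> {s}"
          using card_less_obtain [OF finite_fibre [OF fin(2)]] by blast
        then show ?thesis using * s by (intro exI [of _ m]) auto
      qed
      then obtain m where m: "(j,m) \<noteq> s" "(j,m) \<in> X \<triangle> Y"
        "\<tau> = (if (j,m) \<in> X then - unit_vec j else unit_vec j)" by blast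
      note st = step [OF refl m]
      have ?double
      proof (intro bexI [OF _ m(2)] conjI)
        show "(j,m) \<noteq> s" by (fact m(1))
        show "X \<triangle> {s,(j,m)} \<in> ?J" "Y \<triangle> {s,(j,m)} \<in> ?J"
          using sub2 [OF m(2)] ii(2,3) unfolding mem_Collect_eq st by blast+
        show "?F (X \<triangle> {s,(j,m)}) + ?F (Y \<triangle> {s,(j,m)}) \<le> ?F X + ?F Y"
          using eff_dom_real_le [OF nm ii(2,3) x y ii(4)] unfolding st x_def [symmetric] y_def [symmetric] .
      qed
      then show ?thesis ..
    qed
  next
    case False
    have "\<exists>m. (i,m) \<in> X \<triangle> Y \<and> ((i,m) \<in> X \<longleftrightarrow> s \<notin> X)"
    proof (cases "s \<in> X")
      case True
      then have "\<not> y i < x i" using False iS unfolding increment_iff \<sigma>_def by auto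
      then have "x i \<le> y i" by simp
      then have "card {m. (i,m) \<in> X} \<le> card {m. (i,m) \<in> Y}"
        unfolding x_def y_def count_vec_def by linarith
      moreover have "k \<in> {m. (i,m) \<in> X}" "k \<notin> {m. (i,m) \<in> Y}" using True s unfolding ik by auto
      ultimately obtain m where "m \<in> {m. (i,m) \<in> Y}" "m \<notin> {m. (i,m) \<in> X}"
        by (rule card_le_obtain [OF finite_fibre [OF fin(2)] finite_fibre [OF fin(1)]])
      then show ?thesis using True by auto
    next
      case sX: False
      then have "\<not> x i < y i" using False iS unfolding increment_iff \<sigma>_def by auto
      then have "y i \<le> x i" by simp
      then have "card {m. (i,m) \<in> Y} \<le> card {m. (i,m) \<in> X}"
        unfolding x_def y_def count_vec_def by linarith
      moreover have "k \<in> {m. (i,m) \<in> Y}" "k \<notin> {m. (i,m) \<in> X}" using sX s unfolding ik by auto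
      ultimately obtain m where "m \<in> {m. (i,m) \<in> X}" "m \<notin> {m. (i,m) \<in> Y}"
        by (rule card_le_obtain [OF finite_fibre [OF fin(1)] finite_fibre [OF fin(2)]])
      then show ?thesis using sX by auto
    qed
    then obtain m where m: "(i,m) \<in> X \<triangle> Y" "(i,m) \<in> X \<longleftrightarrow> s \<notin> X" by blast
    then have ne: "(i,m) \<noteq> s" by auto
    have "- \<sigma> = (if (i,m) \<in> X then - unit_vec i else unit_vec i)"
      using m(2) by (simp add: \<sigma>_def)
    note st = step [OF refl ne m(1) this]
    have ?double
    proof (intro bexI [OF _ m(1)] conjI)
      show "(i,m) \<noteq> s" by (fact ne)
      have xy: "x + \<sigma> + - \<sigma> = x" "y - \<sigma> - - \<sigma> = y" by simp_all
      show "X \<triangle> {s,(i,m)} \<in> ?J" "Y \<triangle> {s,(i,m)} \<in> ?J"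
        using sub2 [OF m(1)] x y unfolding mem_Collect_eq st xy by blast+
      show "?F (X \<triangle> {s,(i,m)}) + ?F (Y \<triangle> {s,(i,m)}) \<le> ?F X + ?F Y"
        unfolding st xy x_def [symmetric] y_def [symmetric] by (rule order_refl)
    qed
    then show ?thesis ..
  qed
qed

text \<open>Direct sums: an exchange takes place within one of the summands.\<close>

lemma nat_valuated_sum:
  assumes 1: "nat_valuated E1 J1 F1" and 2: "nat_valuated E2 J2 F2"
  shows "nat_valuated (Inl ` E1 \<union> Inr ` E2) {X. Inl -` X \<in> J1 \<and> Inr -` X \<in> J2}
    (\<lambda>X. F1 (Inl -` X) + F2 (Inr -` X))"
  unfolding nat_valuated_def
proof (intro conjI ballI)
  let ?J = "{X. Inl -` X \<in> J1 \<and> Inr -` X \<in> J2}" and ?F = "\<lambda>X. F1 (Inl -` X) + F2 (Inr -` X)"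
  have E: "finite E1" "finite E2" "J1 \<subseteq> Pow E1" "J2 \<subseteq> Pow E2"
    using 1 2 by (auto simp: nat_valuated_def)
  show "finite (Inl ` E1 \<union> Inr ` E2)" using E by simp
  show "?J \<subseteq> Pow (Inl ` E1 \<union> Inr ` E2)"
  proof
    fix X assume "X \<in> ?J"
    then have "Inl -` X \<subseteq> E1" "Inr -` X \<subseteq> E2" using E by blast+
    then have "u \<in> Inl ` E1 \<union> Inr ` E2" if "u \<in> X" for u using that by (cases u) auto
    then show "X \<in> Pow (Inl ` E1 \<union> Inr ` E2)" by blast
  qed
  fix X Y s assume X: "X \<in> ?J" and Y: "Y \<in> ?J" and s: "s \<in> X \<triangle> Y"
  have v: "Inl -` {Inl e} = {e}" "Inr -` {Inl e} = {}" "Inl -` {Inr d} = {}" "Inr -` {Inr d} = {d}"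
    "Inl -` {Inl e, Inl e'} = {e,e'}" "Inr -` {Inl e, Inl e'} = {}"
    "Inr -` {Inr d, Inr d'} = {d,d'}" "Inl -` {Inr d, Inr d'} = {}" for e e' :: 'a and d d' :: 'b
    by auto
  have empty: "Z \<triangle> {} = Z" for Z :: "'z set" by (simp add: tog_def)
  show "(X \<triangle> {s} \<in> ?J \<and> Y \<triangle> {s} \<in> ?J \<and> ?F (X \<triangle> {s}) + ?F (Y \<triangle> {s}) \<le> ?F X + ?F Y) \<or>
    (\<exists>t\<in>X \<triangle> Y. t \<noteq> s \<and> X \<triangle> {s,t} \<in> ?J \<and> Y \<triangle> {s,t} \<in> ?J \<and>
       ?F (X \<triangle> {s,t}) + ?F (Y \<triangle> {s,t}) \<le> ?F X + ?F Y)" (is "?single \<or> ?double")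
  proof (cases s)
    case (Inl e)
    have "e \<in> Inl -` X \<triangle> Inl -` Y" using s unfolding Inl by simp
    then have m: "Inl -` X \<in> J1" "Inl -` Y \<in> J1" "e \<in> Inl -` X \<triangle> Inl -` Y" using X Y by simp_all
    from 1 m show ?thesis
    proof (cases rule: nat_valuatedE)
      case single
      then have ?single using X Y unfolding Inl mem_Collect_eq vimage_tog v empty by simp
      then show ?thesis ..
    next
      case (double t)
      have ?double
        using X Y double unfolding Inl mem_Collect_eq
        by (intro bexI [of _ "Inl t"]) (simp_all add: vimage_tog v empty)
      then show ?thesis ..
    qed
  next
    case (Inr e)
    have "e \<in> Inr -` X \<triangle> Inr -` Y" using s unfolding Inr by simp
    then have m: "Inr -` X \<in> J2" "Inr -` Y \<in> J2" "e \<in> Inr -` X \<triangle> Inr -` Y" using X Y by simp_all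
    from 2 m show ?thesis
    proof (cases rule: nat_valuatedE)
      case single
      then have ?single using X Y unfolding Inr mem_Collect_eq vimage_tog v empty by simp
      then show ?thesis ..
    next
      case (double t)
      have ?double
        using X Y double unfolding Inr mem_Collect_eq
        by (intro bexI [of _ "Inr t"]) (simp_all add: vimage_tog v empty)
      then show ?thesis ..
    qed
  qed
qed

section \<open>The composition\<close>

text \<open>The copies needed to pass from \<open>inf a b\<close> to \<open>a\<close>.  The sets \<open>up_box S a b\<close> and \<open>up_box S b a\<close> are disjoint, and
  over the lower corner \<open>inf a b\<close> they represent \<open>a\<close> and \<open>b\<close>.\<close>

definition up_box :: "'a set \<Rightarrow> ('a \<Rightarrow> int) \<Rightarrow> ('a \<Rightarrow> int) \<Rightarrow> ('a \<times> nat) set" where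
  "up_box S a b = {(i,k). i \<in> S \<and> int k < a i - b i}"

lemma finite_up_box:
  assumes "finite S"
  shows "finite (up_box S a b)"
proof -
  have "up_box S a b \<subseteq> Sigma S (\<lambda>i. {..<nat (a i - b i)})" by (auto simp: up_box_def)
  then show ?thesis by (rule finite_subset) (use assms in simp)
qed

lemma count_vec_up_box:
  assumes "a \<in> int_vecs S" "b \<in> int_vecs S"
  shows "count_vec (inf a b) (up_box S a b) = a"
proof
  fix i
  have "{k. (i,k) \<in> up_box S a b} = (if i \<in> S then {..<nat (a i - b i)} else {})"
    by (auto simp: up_box_def)
  then show "count_vec (inf a b) (up_box S a b) i = a i"
    using assms by (auto simp: count_vec_def int_vecs_def inf_min)
qed

text \<open>In a set of the lifted direct sum, \<open>Inl (i,k)\<close> is a copy of a coordinate of the first summand and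
  \<open>Inr (i,k)\<close> one of the second.  The free vector keeps the coordinates in \<open>N1\<close> and \<open>N2\<close>, those that are not
  identified with each other.\<close>

definition free_vec :: "'a set \<Rightarrow> 'a set \<Rightarrow> ('a \<Rightarrow> int) \<Rightarrow> (('a \<times> nat) + ('a \<times> nat)) option set \<Rightarrow> 'a \<Rightarrow> int" where
  "free_vec N1 N2 l X = (\<lambda>i. if i \<in> N1 then l i + int (card {k. Some (Inl (i,k)) \<in> X})
     else if i \<in> N2 then l i + int (card {k. Some (Inr (i,k)) \<in> X}) else 0)"

text \<open>The change of the represented vector when \<open>e\<close> is toggled in \<open>X\<close>; the parity element \<open>None\<close> changes nothing.\<close>

definition free_dir :: "(('a \<times> nat) + ('a \<times> nat)) option set \<Rightarrow> (('a \<times> nat) + ('a \<times> nat)) option \<Rightarrow> 'a \<Rightarrow> int" where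
  "free_dir X e = (case e of None \<Rightarrow> 0 | Some u \<Rightarrow>
     (let i = fst (case_sum id id u) in if e \<in> X then - unit_vec i else unit_vec i))"

lemma free_vec_tog:
  assumes fin: "finite X" and "N1 \<inter> N2 = {}"
    and e: "e = None \<or> (\<exists>i\<in>N1. \<exists>k. e = Some (Inl (i,k))) \<or> (\<exists>i\<in>N2. \<exists>k. e = Some (Inr (i,k)))"
  shows "free_vec N1 N2 l (X \<triangle> {e}) = free_vec N1 N2 l X + free_dir X e"
proof
  fix j
  have finL: "finite {k. Some (Inl (i,k)) \<in> X}" and finR: "finite {k. Some (Inr (i,k)) \<in> X}" for i
    using finite_vimageI [OF fin, of "\<lambda>k. Some (Inl (i,k))"] finite_vimageI [OF fin, of "\<lambda>k. Some (Inr (i,k))"]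
    by (simp_all add: inj_def vimage_def)
  from e consider (N) "e = None" | (L) i k where "i \<in> N1" "e = Some (Inl (i,k))"
    | (R) i k where "i \<in> N2" "e = Some (Inr (i,k))" by blast
  then show "free_vec N1 N2 l (X \<triangle> {e}) j = (free_vec N1 N2 l X + free_dir X e) j"
  proof cases
    case N
    then show ?thesis by (simp add: free_vec_def free_dir_def)
  next
    case L
    have 1: "{k'. Some (Inl (j,k')) \<in> X \<triangle> {e}} =
        (if j = i then {k'. Some (Inl (i,k')) \<in> X} \<triangle> {k} else {k'. Some (Inl (j,k')) \<in> X})"
      unfolding L by (auto simp: tog_def)
    have 2: "{k'. Some (Inr (j,k')) \<in> X \<triangle> {e}} = {k'. Some (Inr (j,k')) \<in> X}"
      unfolding L by (auto simp: tog_def)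
    show ?thesis
      using card_tog_singleton [OF finL, of i k] L(1)
      unfolding free_vec_def 1 2 by (auto simp: free_dir_def L(2) unit_vec_def)
  next
    case R
    have 1: "{k'. Some (Inr (j,k')) \<in> X \<triangle> {e}} =
        (if j = i then {k'. Some (Inr (i,k')) \<in> X} \<triangle> {k} else {k'. Some (Inr (j,k')) \<in> X})"
      unfolding R by (auto simp: tog_def)
    have 2: "{k'. Some (Inl (j,k')) \<in> X \<triangle> {e}} = {k'. Some (Inl (j,k')) \<in> X}"
      unfolding R by (auto simp: tog_def)
    have "i \<notin> N1" using R(1) assms(2) by blast
    then show ?thesis
      using card_tog_singleton [OF finR, of i k] R(1)
      unfolding free_vec_def 1 2 by (auto simp: free_dir_def R(2) unit_vec_def)
  qed
qed

text \<open>The exchange for the composition with explicit vectors in place of the infimum.  All vectors between the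
  given ones are represented by sets of copies; balanced sets, which contain \<open>Inl (i,k)\<close> if and only if they
  contain \<open>Inr (i,k)\<close> for all \<open>i \<in> N0\<close>, are the pairs of vectors that agree on \<open>N0\<close>.\<close>

lemma composition_exchange:
  fixes S1 S2 :: "'a set"
  assumes fin: "finite S1" "finite S2"
    and N0: "N0 = S1 \<inter> S2" and N1: "N1 = S1 - N0" and N2: "N2 = S2 - N0"
    and f1: "jump_M_nat_convex S1 f1" and f2: "jump_M_nat_convex S2 f2"
    and x: "x \<in> int_vecs (N1 \<union> N2)" and y: "y \<in> int_vecs (N1 \<union> N2)"
    and a1: "vec_pair N1 N0 x z \<in> eff_dom S1 f1" and a2: "vec_pair N2 N0 x z \<in> eff_dom S2 f2"
    and b1: "vec_pair N1 N0 y z' \<in> eff_dom S1 f1" and b2: "vec_pair N2 N0 y z' \<in> eff_dom S2 f2"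
    and inc: "increment (N1 \<union> N2) x y s"
  shows "\<exists>t w w'. (t = 0 \<or> increment (N1 \<union> N2) (x + s) y t) \<and> w \<in> int_vecs N0 \<and> w' \<in> int_vecs N0 \<and>
    vec_pair N1 N0 (x + s + t) w \<in> eff_dom S1 f1 \<and> vec_pair N2 N0 (x + s + t) w \<in> eff_dom S2 f2 \<and>
    vec_pair N1 N0 (y - s - t) w' \<in> eff_dom S1 f1 \<and> vec_pair N2 N0 (y - s - t) w' \<in> eff_dom S2 f2 \<and>
    real_of_ereal (f1 (vec_pair N1 N0 (x + s + t) w)) + real_of_ereal (f2 (vec_pair N2 N0 (x + s + t) w)) +
    (real_of_ereal (f1 (vec_pair N1 N0 (y - s - t) w')) + real_of_ereal (f2 (vec_pair N2 N0 (y - s - t) w'))) \<le>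
    real_of_ereal (f1 (vec_pair N1 N0 x z)) + real_of_ereal (f2 (vec_pair N2 N0 x z)) +
    (real_of_ereal (f1 (vec_pair N1 N0 y z')) + real_of_ereal (f2 (vec_pair N2 N0 y z')))"
proof -
  define A1 A2 B1 B2 where AB: "A1 = vec_pair N1 N0 x z" "A2 = vec_pair N2 N0 x z"
    "B1 = vec_pair N1 N0 y z'" "B2 = vec_pair N2 N0 y z'"
  define l1 l2 where l12: "l1 = inf A1 B1" "l2 = inf A2 B2"
  define E1 E2 where E: "E1 = up_box S1 A1 B1 \<union> up_box S1 B1 A1" "E2 = up_box S2 A2 B2 \<union> up_box S2 B2 A2"
  define J1 J2 where J12: "J1 = {X. X \<subseteq> E1 \<and> count_vec l1 X \<in> eff_dom S1 f1}"
    "J2 = {X. X \<subseteq> E2 \<and> count_vec l2 X \<in> eff_dom S2 f2}"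
  define F1 F2 where F12: "F1 = (\<lambda>X. real_of_ereal (f1 (count_vec l1 X)))"
    "F2 = (\<lambda>X. real_of_ereal (f2 (count_vec l2 X)))"
  have vecs: "A1 \<in> int_vecs S1" "A2 \<in> int_vecs S2" "B1 \<in> int_vecs S1" "B2 \<in> int_vecs S2"
    using a1 a2 b1 b2 by (simp_all add: AB eff_dom_def)
  have finE: "finite E1" "finite E2" using fin by (simp_all add: E finite_up_box)
  have disj: "N1 \<inter> N2 = {}" "N1 \<inter> N0 = {}" "N2 \<inter> N0 = {}" using N0 N1 N2 by blast+
  have S12: "S1 = N1 \<union> N0" "S2 = N2 \<union> N0" using N0 N1 N2 by blast+
  have val1: "A1 i = x i" "B1 i = y i" if "i \<in> N1" for i using that by (simp_all add: AB vec_pair_def)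
  have val2: "A2 i = x i" "B2 i = y i" if "i \<in> N2" for i using that by (simp_all add: AB vec_pair_def)
  have val0: "A1 i = A2 i" "B1 i = B2 i" if "i \<in> N0" for i
    using that disj by (auto simp: AB vec_pair_def)
  have nv1: "nat_valuated E1 J1 F1" unfolding J12 F12
    by (rule nat_valuated_split [OF f1 finE(1)]) (auto simp: E up_box_def)
  have nv2: "nat_valuated E2 J2 F2" unfolding J12 F12
    by (rule nat_valuated_split [OF f2 finE(2)]) (auto simp: E up_box_def)
  define J where "J = lift_dom (Inl ` E1 \<union> Inr ` E2) {X. Inl -` X \<in> J1 \<and> Inr -` X \<in> J2}"
  define F where "F = (\<lambda>X. F1 (Inl -` (Some -` X)) + F2 (Inr -` (Some -` X)))"
  have ev: "even_valuated (insert None (Some ` (Inl ` E1 \<union> Inr ` E2))) J F"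
    using even_valuated_lift [OF nat_valuated_sum [OF nv1 nv2]] unfolding J_def F_def .
  have finJ: "finite X" if "X \<in> J" for X
    using that finE unfolding J_def lift_dom_def
    by (metis (no_types, lifting) finite.insertI finite_Un finite_imageI finite_subset mem_Collect_eq)
  \<comment> \<open>Two sets of copies as a subset of the direct sum, completed by \<open>None\<close> to even cardinality.\<close>
  define rep where "rep = (\<lambda>P Q. let U = Some ` (Inl ` P \<union> Inr ` Q) in
    if even (card U) then U else insert None U :: (('a \<times> nat) + ('a \<times> nat)) option set)"
  have rep_vimage: "Inl -` (Some -` rep P Q) = P" "Inr -` (Some -` rep P Q) = Q" for P Q
    by (auto simp: rep_def Let_def)
  have rep_Some: "Some (Inl e) \<in> rep P Q \<longleftrightarrow> e \<in> P" "Some (Inr e) \<in> rep P Q \<longleftrightarrow> e \<in> Q" for P Q e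
    by (auto simp: rep_def Let_def)
  have rep_J: "rep P Q \<in> J" if "P \<in> J1" "Q \<in> J2" for P Q
  proof -
    have sub: "P \<subseteq> E1" "Q \<subseteq> E2" using that by (simp_all add: J12)
    then have finU: "finite (Some ` (Inl ` P \<union> Inr ` Q))" using finE finite_subset by blast
    have "None \<notin> Some ` (Inl ` P \<union> Inr ` Q)" by blast
    then have "even (card (rep P Q))" using finU by (simp add: rep_def Let_def)
    moreover have "rep P Q \<subseteq> insert None (Some ` (Inl ` E1 \<union> Inr ` E2))"
      using sub by (auto simp: rep_def Let_def)
    ultimately show ?thesis using that by (simp add: J_def lift_dom_def rep_vimage)
  qed
  define X where "X = rep (up_box S1 A1 B1) (up_box S2 A2 B2)"
  define Y where "Y = rep (up_box S1 B1 A1) (up_box S2 B2 A2)"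
  have cX: "count_vec l1 (up_box S1 A1 B1) = A1" "count_vec l2 (up_box S2 A2 B2) = A2"
    using count_vec_up_box vecs by (simp_all add: l12)
  have cY: "count_vec l1 (up_box S1 B1 A1) = B1" "count_vec l2 (up_box S2 B2 A2) = B2"
    using count_vec_up_box [OF vecs(3,1)] count_vec_up_box [OF vecs(4,2)]
    by (simp_all add: l12 inf_commute)
  have XJ: "X \<in> J" unfolding X_def
    by (rule rep_J) (use a1 a2 in \<open>auto simp: J12 cX AB(1,2) [symmetric] E\<close>)
  have YJ: "Y \<in> J" unfolding Y_def
    by (rule rep_J) (use b1 b2 in \<open>auto simp: J12 cY AB(3,4) [symmetric] E\<close>)
  have FX: "F X = real_of_ereal (f1 A1) + real_of_ereal (f2 A2)"
    by (simp add: F_def X_def rep_vimage F12 cX)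
  have FY: "F Y = real_of_ereal (f1 B1) + real_of_ereal (f2 B2)"
    by (simp add: F_def Y_def rep_vimage F12 cY)
  have memX: "Some (Inl (i,k)) \<in> X \<longleftrightarrow> i \<in> S1 \<and> int k < A1 i - B1 i"
    "Some (Inr (i,k)) \<in> X \<longleftrightarrow> i \<in> S2 \<and> int k < A2 i - B2 i" for i k
    by (simp_all add: X_def rep_Some up_box_def)
  have memY: "Some (Inl (i,k)) \<in> Y \<longleftrightarrow> i \<in> S1 \<and> int k < B1 i - A1 i"
    "Some (Inr (i,k)) \<in> Y \<longleftrightarrow> i \<in> S2 \<and> int k < B2 i - A2 i" for i k
    by (simp_all add: Y_def rep_Some up_box_def)
  define l where "l = (\<lambda>i. if i \<in> N1 then l1 i else l2 i)"
  let ?\<pi> = "free_vec N1 N2 l"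
  define \<alpha> \<beta> :: "'a \<times> nat \<Rightarrow> (('a \<times> nat) + ('a \<times> nat)) option" where
    "\<alpha> = (\<lambda>e. Some (Inl e))" and "\<beta> = (\<lambda>e. Some (Inr e))"
  define I where "I = {(i,k)\<in>E1 \<union> E2. i \<in> N0}"
  let ?D = "\<alpha> ` I \<union> \<beta> ` I"
  define free where "free = (\<lambda>e. e = None \<or> (\<exists>i\<in>N1. \<exists>k. e = Some (Inl (i,k :: nat))) \<or>
      (\<exists>i\<in>N2. \<exists>k. e = Some (Inr (i,k :: nat))))"
  \<comment> \<open>A balanced feasible set represents two vectors with the same components on \<open>N0\<close>.\<close>
  have pi_eq: "count_vec l1 (Inl -` (Some -` Z)) = vec_pair N1 N0 (?\<pi> Z) (\<lambda>i. if i \<in> N0 then count_vec l1 (Inl -` (Some -` Z)) i else 0)"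
     "count_vec l2 (Inr -` (Some -` Z)) = vec_pair N2 N0 (?\<pi> Z) (\<lambda>i. if i \<in> N0 then count_vec l1 (Inl -` (Some -` Z)) i else 0)"
    if Z: "Z \<in> J" and bal: "\<And>e. e \<in> I \<Longrightarrow> \<alpha> e \<in> Z \<longleftrightarrow> \<beta> e \<in> Z" for Z
  proof -
    have Z12: "Inl -` (Some -` Z) \<in> J1" "Inr -` (Some -` Z) \<in> J2"
      using Z by (simp_all add: J_def lift_dom_def)
    have out: "count_vec l1 (Inl -` (Some -` Z)) \<in> int_vecs S1" "count_vec l2 (Inr -` (Some -` Z)) \<in> int_vecs S2"
      using Z12 by (simp_all add: J12 eff_dom_def)
    have fib: "{k. (i,k) \<in> Inl -` (Some -` Z)} = {k. (i,k) \<in> Inr -` (Some -` Z)}" if "i \<in> N0" for i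
    proof (intro set_eqI)
      fix k
      show "k \<in> {k. (i,k) \<in> Inl -` (Some -` Z)} \<longleftrightarrow> k \<in> {k. (i,k) \<in> Inr -` (Some -` Z)}"
      proof (cases "(i,k) \<in> E1 \<union> E2")
        case True
        then show ?thesis using bal [of "(i,k)"] that by (simp add: I_def \<alpha>_def \<beta>_def)
      next
        case False
        then show ?thesis using Z12 unfolding J12 by blast
      qed
    qed
    have c0: "count_vec l1 (Inl -` (Some -` Z)) i = count_vec l2 (Inr -` (Some -` Z)) i" if "i \<in> N0" for i
      using fib [OF that] val0 [OF that] by (simp add: count_vec_def l12)
    show "count_vec l1 (Inl -` (Some -` Z)) = vec_pair N1 N0 (?\<pi> Z) (\<lambda>i. if i \<in> N0 then count_vec l1 (Inl -` (Some -` Z)) i else 0)"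
    proof
      fix i
      show "count_vec l1 (Inl -` (Some -` Z)) i = vec_pair N1 N0 (?\<pi> Z) (\<lambda>i. if i \<in> N0 then count_vec l1 (Inl -` (Some -` Z)) i else 0) i"
        using out(1) S12(1) by (auto simp: vec_pair_def free_vec_def l_def int_vecs_def count_vec_def)
    qed
    show "count_vec l2 (Inr -` (Some -` Z)) = vec_pair N2 N0 (?\<pi> Z) (\<lambda>i. if i \<in> N0 then count_vec l1 (Inl -` (Some -` Z)) i else 0)"
    proof
      fix i
      show "count_vec l2 (Inr -` (Some -` Z)) i = vec_pair N2 N0 (?\<pi> Z) (\<lambda>i. if i \<in> N0 then count_vec l1 (Inl -` (Some -` Z)) i else 0) i"
      proof (cases "i \<in> N2")
        case True
        then have "i \<notin> N1" using disj by blast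
        then show ?thesis using True by (simp add: vec_pair_def free_vec_def l_def count_vec_def)
      next
        case False
        then show ?thesis using out(2) S12(2) c0 by (auto simp: vec_pair_def int_vecs_def)
      qed
    qed
  qed
  have pi_cong: "?\<pi> Z = ?\<pi> Z'" if "Z - ?D = Z' - ?D" for Z Z'
  proof -
    have "Some (Inl (i,k)) \<in> Z \<longleftrightarrow> Some (Inl (i,k)) \<in> Z'" if "i \<in> N1" for i k
    proof -
      have "i \<notin> N0" using that disj by blast
      then have "Some (Inl (i,k)) \<notin> ?D" by (auto simp: \<alpha>_def \<beta>_def I_def)
      then show ?thesis using \<open>Z - ?D = Z' - ?D\<close> by blast
    qed
    moreover have "Some (Inr (i,k)) \<in> Z \<longleftrightarrow> Some (Inr (i,k)) \<in> Z'" if "i \<in> N2" for i k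
    proof -
      have "i \<notin> N0" using that disj by blast
      then have "Some (Inr (i,k)) \<notin> ?D" by (auto simp: \<alpha>_def \<beta>_def I_def)
      then show ?thesis using \<open>Z - ?D = Z' - ?D\<close> by blast
    qed
    ultimately show ?thesis by (auto simp: free_vec_def)
  qed
  have balX: "\<alpha> e \<in> X \<longleftrightarrow> \<beta> e \<in> X" "\<alpha> e \<in> Y \<longleftrightarrow> \<beta> e \<in> Y" if "e \<in> I" for e
  proof -
    obtain i k where e: "e = (i,k)" "i \<in> N0" using \<open>e \<in> I\<close> by (auto simp: I_def)
    have "i \<in> S1" "i \<in> S2" using e S12 by blast+
    then show "\<alpha> e \<in> X \<longleftrightarrow> \<beta> e \<in> X" "\<alpha> e \<in> Y \<longleftrightarrow> \<beta> e \<in> Y"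
      using val0 [OF e(2)] by (simp_all add: \<alpha>_def \<beta>_def e(1) memX memY)
  qed
  have piX: "?\<pi> X = x"
  proof
    fix i
    have "{k. Some (Inl (i,k)) \<in> X} = {..<nat (A1 i - B1 i)}" if "i \<in> N1"
      using that S12 by (auto simp: memX)
    moreover have "{k. Some (Inr (i,k)) \<in> X} = {..<nat (A2 i - B2 i)}" if "i \<in> N2"
      using that S12 by (auto simp: memX)
    ultimately show "?\<pi> X i = x i"
      using x val1 [of i] val2 [of i]
      by (auto simp: free_vec_def l_def l12 int_vecs_def inf_min)
  qed
  have piY: "?\<pi> Y = y"
  proof
    fix i
    have "{k. Some (Inl (i,k)) \<in> Y} = {..<nat (B1 i - A1 i)}" if "i \<in> N1"
      using that S12 by (auto simp: memY)
    moreover have "{k. Some (Inr (i,k)) \<in> Y} = {..<nat (B2 i - A2 i)}" if "i \<in> N2"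
      using that S12 by (auto simp: memY)
    ultimately show "?\<pi> Y i = y i"
      using y val1 [of i] val2 [of i]
      by (auto simp: free_vec_def l_def l12 int_vecs_def inf_min)
  qed
  \<comment> \<open>The given increment toggles the copy of its coordinate with number 0.\<close>
  obtain i where i: "i \<in> N1 \<union> N2" "s = unit_vec i \<and> x i < y i \<or> s = - unit_vec i \<and> y i < x i"
    using inc unfolding increment_iff by blast
  define \<sigma> :: "(('a \<times> nat) + ('a \<times> nat)) option" where
    "\<sigma> = (if i \<in> N1 then Some (Inl (i,0)) else Some (Inr (i,0)))"
  have \<sigma>_free: "free \<sigma>" using i(1) by (auto simp: \<sigma>_def free_def)
  have \<sigma>X: "\<sigma> \<in> X \<longleftrightarrow> y i < x i" and \<sigma>Y: "\<sigma> \<in> Y \<longleftrightarrow> x i < y i"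
    using i(1) val1 [of i] val2 [of i] S12 by (auto simp: \<sigma>_def memX memY)
  have \<sigma>XY: "\<sigma> \<in> X \<triangle> Y" using i(2) \<sigma>X \<sigma>Y by auto
  have free_D: "e \<notin> ?D" if "free e" for e
    using that disj by (auto simp: free_def \<alpha>_def \<beta>_def I_def)
  have free_XY: "free e" if "e \<in> X \<triangle> Y - ?D" for e
  proof -
    consider "e = None" | i k where "e = Some (Inl (i,k))" | i k where "e = Some (Inr (i,k))"
      by (metis not_None_eq old.sum.exhaust surj_pair)
    then show ?thesis
    proof cases
      case 1
      then show ?thesis by (simp add: free_def)
    next
      case (2 i k)
      then have S: "i \<in> S1" "(i,k) \<in> E1" using that by (auto simp: memX memY E up_box_def)
      then have "i \<notin> N0" using that 2 by (auto simp: \<alpha>_def I_def)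
      then show ?thesis using S 2 by (auto simp: free_def N1)
    next
      case (3 i k)
      then have S: "i \<in> S2" "(i,k) \<in> E2" using that by (auto simp: memX memY E up_box_def)
      then have "i \<notin> N0" using that 3 by (auto simp: \<beta>_def I_def)
      then show ?thesis using S 3 by (auto simp: free_def N2)
    qed
  qed
  have dirY: "free_dir Y e = - free_dir X e" if "e \<in> X \<triangle> Y" for e
    using that by (auto simp: free_dir_def Let_def split: option.split)
  have finI: "finite I" by (rule finite_subset [of _ "E1 \<union> E2"]) (use finE in \<open>auto simp: I_def\<close>)
  have "\<exists>t\<in>X \<triangle> Y - ?D. t \<noteq> \<sigma> \<and> (\<exists>X'\<in>J. \<exists>Y'\<in>J.
      (\<forall>e\<in>I. \<alpha> e \<in> X' \<longleftrightarrow> \<beta> e \<in> X') \<and> (\<forall>e\<in>I. \<alpha> e \<in> Y' \<longleftrightarrow> \<beta> e \<in> Y') \<and>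
      X' - ?D = X \<triangle> {\<sigma>,t} - ?D \<and> Y' - ?D = Y \<triangle> {\<sigma>,t} - ?D \<and> F X' + F Y' \<le> F X + F Y)"
    by (rule even_valuated_merge_pairs [OF finI _ _ _ ev XJ YJ])
      (use balX \<sigma>XY free_D [OF \<sigma>_free] in \<open>simp_all add: \<alpha>_def \<beta>_def inj_def\<close>)
  then obtain \<tau> X' Y' where \<tau>: "\<tau> \<in> X \<triangle> Y - ?D" "\<tau> \<noteq> \<sigma>" and X': "X' \<in> J" and Y': "Y' \<in> J"
    and bal: "\<forall>e\<in>I. \<alpha> e \<in> X' \<longleftrightarrow> \<beta> e \<in> X'" "\<forall>e\<in>I. \<alpha> e \<in> Y' \<longleftrightarrow> \<beta> e \<in> Y'"
    and eq: "X' - ?D = X \<triangle> {\<sigma>,\<tau>} - ?D" "Y' - ?D = Y \<triangle> {\<sigma>,\<tau>} - ?D"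
    and le: "F X' + F Y' \<le> F X + F Y"
    by (elim bexE conjE)
  define t where "t = free_dir X \<tau>"
  have \<tau>_free: "free \<tau>" by (rule free_XY [OF \<tau>(1)])
  have "free_dir X \<sigma> = (if \<sigma> \<in> X then - unit_vec i else unit_vec i)"
    by (cases "i \<in> N1") (simp_all add: free_dir_def \<sigma>_def)
  then have dir\<sigma>: "free_dir X \<sigma> = s"
    using i(2) \<sigma>X by auto
  have tog2: "?\<pi> (Z \<triangle> {\<sigma>,\<tau>}) = ?\<pi> Z + free_dir Z \<sigma> + free_dir Z \<tau>" if "finite Z" for Z
  proof -
    have "free_dir (Z \<triangle> {\<sigma>}) \<tau> = free_dir Z \<tau>"
      using \<tau>(2) by (auto simp: free_dir_def Let_def split: option.split)
    then show ?thesis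
      unfolding tog_pair [OF \<tau>(2) [symmetric]]
      using free_vec_tog [OF _ disj(1) \<tau>_free [unfolded free_def], of "Z \<triangle> {\<sigma>}" l]
        free_vec_tog [OF that disj(1) \<sigma>_free [unfolded free_def], of l] that
      by (simp add: finite_tog)
  qed
  have piX': "?\<pi> X' = x + s + t"
    using pi_cong [OF eq(1)] tog2 [OF finJ [OF XJ]] by (simp add: piX dir\<sigma> t_def)
  have piY': "?\<pi> Y' = y - s - t"
    using pi_cong [OF eq(2)] tog2 [OF finJ [OF YJ]] dirY [OF \<sigma>XY] dirY [of \<tau>] \<tau>(1)
    by (simp add: piY dir\<sigma> t_def)
  have t_inc: "t = 0 \<or> increment (N1 \<union> N2) (x + s) y t"
  proof (cases "\<tau> = None")
    case True
    then show ?thesis by (simp add: t_def free_dir_def)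
  next
    case False
    then obtain j k where jk: "j \<in> N1 \<and> \<tau> = Some (Inl (j,k)) \<or> j \<in> N2 \<and> \<tau> = Some (Inr (j,k))"
      using \<tau>_free unfolding free_def by blast
    have j: "j \<in> N1 \<union> N2" using jk by blast
    have t: "t = (if \<tau> \<in> X then - unit_vec j else unit_vec j)"
      using jk by (auto simp: t_def free_dir_def)
    have \<tau>X: "\<tau> \<in> X \<longleftrightarrow> int k < x j - y j" and \<tau>Y: "\<tau> \<in> Y \<longleftrightarrow> int k < y j - x j"
      using jk val1 [of j] val2 [of j] S12 by (auto simp: memX memY)
    \<comment> \<open>Copy 0 of coordinate \<open>i\<close> is used up, so a further exchange at \<open>i\<close> requires distance at least two there.\<close>
    have k: "k \<noteq> 0" if "j = i"
    proof -
      have "j \<notin> N1" if "j \<in> N2" using that disj(1) by blast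
      then show ?thesis using \<tau>(2) jk \<open>j = i\<close> by (auto simp: \<sigma>_def)
    qed
    have sj: "s j = (if j = i then (if x i < y i then 1 else - 1) else 0)"
      using i(2) by (auto simp: unit_vec_def)
    have "\<tau> \<in> X \<and> y j < (x + s) j \<or> \<tau> \<in> Y \<and> \<tau> \<notin> X \<and> (x + s) j < y j"
      using \<tau>(1) \<tau>X \<tau>Y k sj by (cases "j = i") auto
    then have "increment (N1 \<union> N2) (x + s) y t"
      unfolding increment_iff using j t by auto
    then show ?thesis ..
  qed
  define w :: "(('a \<times> nat) + ('a \<times> nat)) option set \<Rightarrow> 'a \<Rightarrow> int" where
    "w = (\<lambda>Z i. if i \<in> N0 then count_vec l1 (Inl -` (Some -` Z)) i else 0)"
  have w: "w Z \<in> int_vecs N0" for Z by (simp add: w_def int_vecs_def)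
  have vX: "count_vec l1 (Inl -` (Some -` X')) = vec_pair N1 N0 (x + s + t) (w X')"
    "count_vec l2 (Inr -` (Some -` X')) = vec_pair N2 N0 (x + s + t) (w X')"
    using pi_eq [OF X'] bal(1) unfolding piX' w_def by blast+
  have vY: "count_vec l1 (Inl -` (Some -` Y')) = vec_pair N1 N0 (y - s - t) (w Y')"
    "count_vec l2 (Inr -` (Some -` Y')) = vec_pair N2 N0 (y - s - t) (w Y')"
    using pi_eq [OF Y'] bal(2) unfolding piY' w_def by blast+
  have domX: "vec_pair N1 N0 (x + s + t) (w X') \<in> eff_dom S1 f1" "vec_pair N2 N0 (x + s + t) (w X') \<in> eff_dom S2 f2"
    using X' unfolding vX [symmetric] by (simp_all add: J_def lift_dom_def J12)
  have domY: "vec_pair N1 N0 (y - s - t) (w Y') \<in> eff_dom S1 f1" "vec_pair N2 N0 (y - s - t) (w Y') \<in> eff_dom S2 f2"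
    using Y' unfolding vY [symmetric] by (simp_all add: J_def lift_dom_def J12)
  have le': "real_of_ereal (f1 (vec_pair N1 N0 (x + s + t) (w X'))) + real_of_ereal (f2 (vec_pair N2 N0 (x + s + t) (w X'))) +
    (real_of_ereal (f1 (vec_pair N1 N0 (y - s - t) (w Y'))) + real_of_ereal (f2 (vec_pair N2 N0 (y - s - t) (w Y')))) \<le> F X + F Y"
    using le unfolding F_def F12 vX vY by simp
  show ?thesis
    using t_inc w [of X'] w [of Y'] domX domY le' unfolding FX FY AB by blast
qed

theorem theorem4p8:
  fixes S1 S2 N0 N1 N2 :: "'a set"
    and f1 f2 g :: "('a \<Rightarrow> int) \<Rightarrow> ereal"
  assumes "finite S1" and "finite S2"
    and "N0 = S1 \<inter> S2" and "N1 = S1 - N0" and "N2 = S2 - N0"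
    and "jump_M_nat_convex S1 f1" and "jump_M_nat_convex S2 f2"
    and "\<And>y1 y2. y1 \<in> int_vecs N1 \<Longrightarrow> y2 \<in> int_vecs N2 \<Longrightarrow>
           g (vec_pair N1 N2 y1 y2) =
             Inf {f1 (vec_pair N1 N0 y1 z1) + f2 (vec_pair N2 N0 y2 z2) | z1 z2.
                    z1 \<in> int_vecs N0 \<and> z2 \<in> int_vecs N0 \<and> z1 = z2}"
    and "\<forall>x \<in> int_vecs (N1 \<union> N2). g x \<noteq> -\<infinity>"
    and "eff_dom (N1 \<union> N2) g \<noteq> {}"
  shows "jump_M_nat_convex (N1 \<union> N2) g"
proof -
  note g_inf = assms(8) and g_nm = assms(9)
  let ?N = "N1 \<union> N2"
  let ?f = "\<lambda>v z. f1 (vec_pair N1 N0 v z) + f2 (vec_pair N2 N0 v z)"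
  have disj: "N1 \<inter> N2 = {}" "S1 = N1 \<union> N0" "S2 = N2 \<union> N0" using assms(3-5) by blast+
  have finN: "finite ?N" using assms(1-5) by simp
  have f_nm: "f1 v \<noteq> -\<infinity>" if "v \<in> int_vecs S1" for v using assms(6) that by (simp add: jump_M_nat_convex_def)
  have f_nm2: "f2 v \<noteq> -\<infinity>" if "v \<in> int_vecs S2" for v using assms(7) that by (simp add: jump_M_nat_convex_def)
  have vp: "vec_pair N1 N0 v z \<in> int_vecs S1" "vec_pair N2 N0 v z \<in> int_vecs S2" for v z
    using disj by (auto simp: vec_pair_def int_vecs_def)
  have g_eq: "g v = Inf {?f v z | z. z \<in> int_vecs N0}" if v: "v \<in> int_vecs ?N" for v
  proof -
    define v1 v2 where "v1 = (\<lambda>i. if i \<in> N1 then v i else 0)" and "v2 = (\<lambda>i. if i \<in> N2 then v i else 0)"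
    have "v1 \<in> int_vecs N1" "v2 \<in> int_vecs N2" by (simp_all add: v1_def v2_def int_vecs_def)
    moreover have "vec_pair N1 N2 v1 v2 = v"
      using v by (auto simp: vec_pair_def v1_def v2_def int_vecs_def)
    moreover have "vec_pair N1 N0 v1 z = vec_pair N1 N0 v z" "vec_pair N2 N0 v2 z = vec_pair N2 N0 v z" for z
      by (auto simp: vec_pair_def v1_def v2_def)
    moreover have "{?f v z | z. z \<in> int_vecs N0} =
        {?f v z1 + 0 | z1 z2. z1 \<in> int_vecs N0 \<and> z2 \<in> int_vecs N0 \<and> z1 = z2}" by auto
    moreover have "{f1 (vec_pair N1 N0 v z1) + f2 (vec_pair N2 N0 v z2) | z1 z2.
       z1 \<in> int_vecs N0 \<and> z2 \<in> int_vecs N0 \<and> z1 = z2} = {?f v z | z. z \<in> int_vecs N0}" by auto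
    ultimately show ?thesis using g_inf [of v1 v2] by simp
  qed
  have "JM_nat_EXC ?N g"
    unfolding JM_nat_EXC_def
  proof (intro ballI allI impI)
    fix x y s assume x: "x \<in> eff_dom ?N g" and y: "y \<in> eff_dom ?N g" and s: "increment ?N x y s"
    have xN: "x \<in> int_vecs ?N" and yN: "y \<in> int_vecs ?N" using x y by (simp_all add: eff_dom_def)
    define T where "T = {t. t = 0 \<or> increment ?N (x + s) y t}"
    have sN: "s \<in> int_vecs ?N" using s by (auto simp: increment_def int_vecs_def unit_vec_def)
    have TN: "t \<in> int_vecs ?N" if "t \<in> T" for t
      using that by (auto simp: T_def increment_def int_vecs_def unit_vec_def)
    have xt: "x + s + t \<in> int_vecs ?N" "y - s - t \<in> int_vecs ?N" if "t \<in> T" for t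
      using xN yN sN TN [OF that] by (simp_all add: int_vecs_def)
    have finT: "finite T"
      by (rule finite_subset [of _ "{0} \<union> unit_vec ` ?N \<union> (\<lambda>i. - unit_vec i) ` ?N"])
        (use finN in \<open>auto simp: T_def increment_def\<close>)
    define val where "val = (\<lambda>t. g (x + s + t) + g (y - s - t))"
    show "x + s \<in> eff_dom ?N g \<and> y - s \<in> eff_dom ?N g \<and> g (x + s) + g (y - s) \<le> g x + g y \<or>
       (\<exists>t. increment ?N (x + s) y t \<and> x + s + t \<in> eff_dom ?N g \<and> y - s - t \<in> eff_dom ?N g \<and>
             g (x + s + t) + g (y - s - t) \<le> g x + g y)"
    proof (rule ccontr)
      assume neg: "\<not> ?thesis"
      have gfin: "g v < \<infinity>" "g v \<noteq> -\<infinity>" if "v \<in> eff_dom ?N g" for v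
        using that g_nm by (simp_all add: eff_dom_def)
      obtain p q where p: "g x = ereal p" and q: "g y = ereal q"
        using gfin [OF x] gfin [OF y] by (metis ereal_cases less_irrefl)
      have big: "g x + g y < val t" if t: "t \<in> T" for t
      proof (cases "x + s + t \<in> eff_dom ?N g \<and> y - s - t \<in> eff_dom ?N g")
        case True
        have "\<not> val t \<le> g x + g y"
          using neg t True by (auto simp: val_def T_def)
        then show ?thesis by simp
      next
        case False
        then have "g (x + s + t) = \<infinity> \<or> g (y - s - t) = \<infinity>"
          using xt [OF t] by (auto simp: eff_dom_def)
        then have "val t = \<infinity>" using g_nm xt [OF t] by (auto simp: val_def)
        then show ?thesis by (simp add: p q)
      qed
      \<comment> \<open>There are finitely many exchanges, so a failure of all of them leaves a gap below \<open>M\<close>, into which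
        near-optimal vectors fit although the infimum need not be attained.\<close>
      define M where "M = Min (val ` T)"
      have "0 \<in> T" by (simp add: T_def)
      then have "M \<in> val ` T" unfolding M_def using finT by (intro Min_in) auto
      then have "ereal (p + q) < M" using big by (auto simp: p q)
      then obtain r where r: "p + q < r" "ereal r < M" using ereal_dense2 by (metis ereal_less_eq(3) less_ereal.simps(1))
      define d where "d = (r - p - q) / 2"
      have near: "\<exists>z. vec_pair N1 N0 v z \<in> eff_dom S1 f1 \<and> vec_pair N2 N0 v z \<in> eff_dom S2 f2 \<and>
          real_of_ereal (f1 (vec_pair N1 N0 v z)) + real_of_ereal (f2 (vec_pair N2 N0 v z)) < c + d"
        if v: "v \<in> int_vecs ?N" and c: "g v = ereal c" for v c
      proof -
        have "g v < ereal (c + d)" using c r by (simp add: d_def)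
        then obtain z where z: "?f v z < ereal (c + d)"
          unfolding g_eq [OF v] Inf_less_iff by blast
        have nm: "f1 (vec_pair N1 N0 v z) \<noteq> -\<infinity>" "f2 (vec_pair N2 N0 v z) \<noteq> -\<infinity>"
          using f_nm f_nm2 vp by blast+
        then obtain r1 r2 where "f1 (vec_pair N1 N0 v z) = ereal r1" "f2 (vec_pair N2 N0 v z) = ereal r2"
          using z by (cases "f1 (vec_pair N1 N0 v z)"; cases "f2 (vec_pair N2 N0 v z)") auto
        then show ?thesis using z vp by (intro exI [of _ z]) (simp add: eff_dom_def)
      qed
      obtain z where z: "vec_pair N1 N0 x z \<in> eff_dom S1 f1" "vec_pair N2 N0 x z \<in> eff_dom S2 f2"
        "real_of_ereal (f1 (vec_pair N1 N0 x z)) + real_of_ereal (f2 (vec_pair N2 N0 x z)) < p + d"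
        using near [OF xN p] by blast
      obtain z' where z': "vec_pair N1 N0 y z' \<in> eff_dom S1 f1" "vec_pair N2 N0 y z' \<in> eff_dom S2 f2"
        "real_of_ereal (f1 (vec_pair N1 N0 y z')) + real_of_ereal (f2 (vec_pair N2 N0 y z')) < q + d"
        using near [OF yN q] by blast
      obtain t w w' where t: "t \<in> T" and w: "w \<in> int_vecs N0" "w' \<in> int_vecs N0"
        and X: "vec_pair N1 N0 (x + s + t) w \<in> eff_dom S1 f1" "vec_pair N2 N0 (x + s + t) w \<in> eff_dom S2 f2"
        and Y: "vec_pair N1 N0 (y - s - t) w' \<in> eff_dom S1 f1" "vec_pair N2 N0 (y - s - t) w' \<in> eff_dom S2 f2"
        and le: "real_of_ereal (f1 (vec_pair N1 N0 (x + s + t) w)) + real_of_ereal (f2 (vec_pair N2 N0 (x + s + t) w)) +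
          (real_of_ereal (f1 (vec_pair N1 N0 (y - s - t) w')) + real_of_ereal (f2 (vec_pair N2 N0 (y - s - t) w'))) \<le>
          real_of_ereal (f1 (vec_pair N1 N0 x z)) + real_of_ereal (f2 (vec_pair N2 N0 x z)) +
          (real_of_ereal (f1 (vec_pair N1 N0 y z')) + real_of_ereal (f2 (vec_pair N2 N0 y z')))"
        using composition_exchange [OF assms(1-7) xN yN z(1,2) z'(1,2) s] unfolding T_def by blast
      have upper: "g v \<le> ereal (real_of_ereal (f1 (vec_pair N1 N0 v u)) + real_of_ereal (f2 (vec_pair N2 N0 v u)))"
        if v: "v \<in> int_vecs ?N" and u: "u \<in> int_vecs N0"
          and dom: "vec_pair N1 N0 v u \<in> eff_dom S1 f1" "vec_pair N2 N0 v u \<in> eff_dom S2 f2" for v u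
      proof -
        have "g v \<le> ?f v u" unfolding g_eq [OF v] using u by (intro Inf_lower) blast
        moreover have "\<bar>f1 (vec_pair N1 N0 v u)\<bar> \<noteq> \<infinity>" "\<bar>f2 (vec_pair N2 N0 v u)\<bar> \<noteq> \<infinity>"
          using dom f_nm f_nm2 vp by (auto simp: eff_dom_def)
        ultimately show ?thesis by (simp add: ereal_real' flip: plus_ereal.simps)
      qed
      have "M \<le> val t" unfolding M_def using finT t by (intro Min_le) auto
      also have "val t \<le> ereal (real_of_ereal (f1 (vec_pair N1 N0 (x + s + t) w)) + real_of_ereal (f2 (vec_pair N2 N0 (x + s + t) w))) +
          ereal (real_of_ereal (f1 (vec_pair N1 N0 (y - s - t) w')) + real_of_ereal (f2 (vec_pair N2 N0 (y - s - t) w')))"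
        unfolding val_def by (intro add_mono upper xt [OF t] w X Y)
      also have "\<dots> \<le> ereal r"
      proof -
        have "p + d + (q + d) = r" by (simp add: d_def field_simps)
        then show ?thesis unfolding plus_ereal.simps ereal_less_eq(3) using le z(3) z'(3) by linarith
      qed
      finally show False using r by simp
    qed
  qed
  then show ?thesis using assms(9,10) by (simp add: jump_M_nat_convex_def)
qed

end
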